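(* Consider latent Dirichlet allocation with true parameter $\theta^\ast=(T_\gamma^\ast,B^\ast)$, $B^\ast=[\beta^\ast_1,\dots,\beta^\ast_K]$, $T_\gamma^\ast=[\gamma_1^\ast,\dots,\gamma_D^\ast]$. Suppose that for each $k=1,\dots,K$ the vector $\beta^\ast_k$ is $d_k$-sparse with $d_k\ll V$, that for each $d=1,\dots,D$ the vector $\gamma^\ast_d$ is $e_d$-sparse with $e_d\ll K$, and that there exists a constant $\delta_0>0$ such that each nonzero component of every $\beta^\ast_k$ and every $\gamma^\ast_d$ is at least $\delta_0$. If $\big(\sum_{d=1}^D e_d+\sum_{k=1}^K d_k\big)/(DN)\to0$ as $N\to\infty$, then with probability tending to one as $N\to\infty$, $$\int D^{-1}\sum_{d=1}^D h^2\big[p_d(\cdot\mid\theta)\,\big\|\,p_d(\cdot\mid\theta^\ast)\big]\,\widehat q_\theta(\theta)\,d\theta\;\lesssim\;\frac{\sum_{d=1}^D e_d}{DN}\log(DKN)+\frac{\sum_{k=1}^K d_k}{DN}\log(KVN).$$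
   Context: Model (latent Dirichlet allocation). $K$ is the number of topics, $V$ the vocabulary size, $D$ the number of documents, $N$ the number of words in each document ($N$ plays the role of sample size). $\mathcal S_m$ denotes the simplex of probability vectors of length $m$. The parameter is $\theta=(T_\gamma,B)$, where $B=[\beta_1,\dots,\beta_K]\in\mathbb R^{V\times K}$ with $\beta_k\in\mathcal S_V$ (word proportions of topic $k$), and $T_\gamma=[\gamma_1,\dots,\gamma_D]\in\mathbb R^{K\times D}$ with $\gamma_d\in\mathcal S_K$ (topic proportions of document $d$). Given $\theta$, independently for each $d=1,\dots,D$ and $n=1,\dots,N$: draw a topic assignment $z_{dn}\sim\mathrm{Cat}(\gamma_d)$ in $\{1,\dots,K\}$, then draw the word $w_{dn}\sim\mathrm{Cat}(\beta_{z_{dn}})$ in $\{1,\dots,V\}$, where $\mathrm{Cat}(\pi)$ is the categorical distribution with probability vector $\pi$. The data are $Y^N=(Y_1,\dots,Y_N)$, $Y_n=\{w_{dn}:d=1,\dots,D\}$, generated under $\theta^\ast$; the latent variables are $S_n=\{z_{dn}:d=1,\dots,D\}$. $p_d(\cdot\mid\theta)$ denotes the probability mass function of a single word $w_{d\cdot}$ of document $d$, i.e. $p_d(v\mid\theta)=\sum_{k=1}^K\gamma_{d,k}\,\beta_{k,v}$. Prior. Independently, $\beta_k\sim\mathrm{Dir}_V(\eta_\beta)$ for $k=1,\dots,K$ and $\gamma_d\sim\mathrm{Dir}_K(\eta_\gamma)$ for $d=1,\dots,D$ (symmetric Dirichlet distributions), with $\eta_\beta=1/V^{c}$, $\eta_\gamma=1/K^{c}$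 for a fixed number $c>1$. Variational solution. The mean-field family consists of distributions of the form $$q(\theta,S^N)=\prod_{k=1}^K q_{\beta_k}(\beta_k)\prod_{d=1}^D\Big(q_{\gamma_d}(\gamma_d)\prod_{n=1}^N q_{z_{dn}}(z_{dn})\Big).$$ $\widehat q$ is the member of this family minimizing the Kullback–Leibler divergence to the joint posterior of $(\theta,S^N)$ given $Y^N$, and $\widehat q_\theta$ is its $\theta$-marginal. Notation. $h(p\,\|\,q)=[\int(\sqrt p-\sqrt q)^2]^{1/2}$ is the Hellinger distance. A vector is $m$-sparse if it has at most $m$ nonzero components. $a\ll b$ means $a$ is much smaller than $b$. $a\lesssim b$ means $a\le Cb$ for some constant $C>0$, independent of $N,D,K,V$ and of the sparsity levels. *)

theory Defs
  imports "HOL-Probability.Probability"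
begin

(* Indices start at 0: topics are k < K, words v < V, documents d < D, positions n < N.
   Vectors are functions nat => real, extensional (i.e. "undefined") off the index set, so that
   they live in the library's product spaces PiM.  In theta = (g, b), g d k is component k of
   gamma_d and b k v is component v of beta_k; assignments z and words w are indexed by (d, n). *)

definition prob_simplex :: "nat \<Rightarrow> (nat \<Rightarrow> real) set" where
  "prob_simplex m = {x \<in> extensional {..<m}. (\<forall>i<m. 0 \<le> x i) \<and> (\<Sum>i<m. x i) = 1}"

definition simplex_space :: "nat \<Rightarrow> (nat \<Rightarrow> real) measure" where
  "simplex_space m = restrict_space (Pi\<^sub>M {..<m} (\<lambda>_. borel)) (prob_simplex m)"

definition m_sparse :: "nat \<Rightarrow> nat \<Rightarrow> (nat \<Rightarrow> real) \<Rightarrow> bool" where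
  "m_sparse m s x \<longleftrightarrow> card {i. i < m \<and> x i \<noteq> 0} \<le> s"

definition cat_pmf :: "nat \<Rightarrow> (nat \<Rightarrow> real) \<Rightarrow> nat pmf" where
  "cat_pmf m p = embed_pmf (\<lambda>i. if i < m then p i else 0)"

(* The symmetric Dirichlet distribution has density
   Gamma(m a) / Gamma(a)^m * prod_{i<m} x_i^(a-1) with respect to Lebesgue measure in the
   coordinates x_0, ..., x_{m-2}, the last one being x_{m-1} = 1 - x_0 - ... - x_{m-2}. *)
definition simplex_chart_dom :: "nat \<Rightarrow> (nat \<Rightarrow> real) set" where
  "simplex_chart_dom m = {x. (\<forall>i<m - 1. 0 \<le> x i) \<and> (\<Sum>i<m - 1. x i) \<le> 1}"

definition simplex_chart :: "nat \<Rightarrow> (nat \<Rightarrow> real) \<Rightarrow> nat \<Rightarrow> real" where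
  "simplex_chart m x = (\<lambda>i\<in>{..<m}. if i < m - 1 then x i else 1 - (\<Sum>j<m - 1. x j))"

definition dirichlet_density :: "nat \<Rightarrow> real \<Rightarrow> (nat \<Rightarrow> real) \<Rightarrow> real" where
  "dirichlet_density m a x =
     Gamma (real m * a) / Gamma a ^ m * (\<Prod>i<m. x i powr (a - 1))"

definition dirichlet :: "nat \<Rightarrow> real \<Rightarrow> (nat \<Rightarrow> real) measure" where
  "dirichlet m a =
     distr
       (density (restrict_space (Pi\<^sub>M {..<m - 1} (\<lambda>_. lborel)) (simplex_chart_dom m))
         (\<lambda>x. ennreal (dirichlet_density m a (simplex_chart m x))))
       (simplex_space m) (simplex_chart m)"

type_synonym lda_param = "(nat \<Rightarrow> nat \<Rightarrow> real) \<times> (nat \<Rightarrow> nat \<Rightarrow> real)"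

definition lda_data_pmf ::
  "nat \<Rightarrow> nat \<Rightarrow> nat \<Rightarrow> nat \<Rightarrow> lda_param \<Rightarrow> (nat \<times> nat \<Rightarrow> nat) pmf" where
  "lda_data_pmf K V D N \<theta> =
     Pi_pmf ({..<D} \<times> {..<N}) 0
       (\<lambda>(d, n). bind_pmf (cat_pmf K (fst \<theta> d)) (\<lambda>k. cat_pmf V (snd \<theta> k)))"

definition word_prob :: "nat \<Rightarrow> lda_param \<Rightarrow> nat \<Rightarrow> nat \<Rightarrow> real" where
  "word_prob K \<theta> d v = (\<Sum>k<K. fst \<theta> d k * snd \<theta> k v)"

definition hellinger :: "'a measure \<Rightarrow> ('a \<Rightarrow> real) \<Rightarrow> ('a \<Rightarrow> real) \<Rightarrow> real" where
  "hellinger M p q = sqrt (\<integral>x. (sqrt (p x) - sqrt (q x))\<^sup>2 \<partial>M)"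

definition lda_param_space :: "nat \<Rightarrow> nat \<Rightarrow> nat \<Rightarrow> lda_param measure" where
  "lda_param_space K V D =
     Pi\<^sub>M {..<D} (\<lambda>_. simplex_space K) \<Otimes>\<^sub>M Pi\<^sub>M {..<K} (\<lambda>_. simplex_space V)"

definition lda_prior :: "real \<Rightarrow> nat \<Rightarrow> nat \<Rightarrow> nat \<Rightarrow> lda_param measure" where
  "lda_prior c K V D =
     Pi\<^sub>M {..<D} (\<lambda>_. dirichlet K (1 / real K powr c))
     \<Otimes>\<^sub>M Pi\<^sub>M {..<K} (\<lambda>_. dirichlet V (1 / real V powr c))"

definition lda_complete_lik ::
  "nat \<Rightarrow> nat \<Rightarrow> (nat \<times> nat \<Rightarrow> nat) \<Rightarrow> lda_param \<times> (nat \<times> nat \<Rightarrow> nat) \<Rightarrow> real" where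
  "lda_complete_lik D N w = (\<lambda>(\<theta>, z). \<Prod>(d, n)\<in>{..<D} \<times> {..<N}.
     fst \<theta> d (z (d, n)) * snd \<theta> (z (d, n)) (w (d, n)))"

(* The base measure is the prior times counting measure on the assignments. *)
definition lda_base :: "real \<Rightarrow> nat \<Rightarrow> nat \<Rightarrow> nat \<Rightarrow> nat \<Rightarrow>
    (lda_param \<times> (nat \<times> nat \<Rightarrow> nat)) measure" where
  "lda_base c K V D N =
     lda_prior c K V D \<Otimes>\<^sub>M Pi\<^sub>M ({..<D} \<times> {..<N}) (\<lambda>_. count_space {..<K})"

definition lda_evidence ::
  "real \<Rightarrow> nat \<Rightarrow> nat \<Rightarrow> nat \<Rightarrow> nat \<Rightarrow> (nat \<times> nat \<Rightarrow> nat) \<Rightarrow> ennreal" where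
  "lda_evidence c K V D N w =
     (\<integral>\<^sup>+x. ennreal (lda_complete_lik D N w x) \<partial>lda_base c K V D N)"

definition lda_posterior :: "real \<Rightarrow> nat \<Rightarrow> nat \<Rightarrow> nat \<Rightarrow> nat \<Rightarrow> (nat \<times> nat \<Rightarrow> nat) \<Rightarrow>
    (lda_param \<times> (nat \<times> nat \<Rightarrow> nat)) measure" where
  "lda_posterior c K V D N w =
     density (lda_base c K V D N)
       (\<lambda>x. ennreal (lda_complete_lik D N w x) / lda_evidence c K V D N w)"

definition mean_field :: "nat \<Rightarrow> nat \<Rightarrow> nat \<Rightarrow> nat \<Rightarrow>
    (lda_param \<times> (nat \<times> nat \<Rightarrow> nat)) measure set" where
  "mean_field K V D N =
     {(Pi\<^sub>M {..<D} qg \<Otimes>\<^sub>M Pi\<^sub>M {..<K} qb) \<Otimes>\<^sub>M Pi\<^sub>M ({..<D} \<times> {..<N}) qz | qg qb qz.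
        (\<forall>d<D. qg d \<in> space (prob_algebra (simplex_space K))) \<and>
        (\<forall>k<K. qb k \<in> space (prob_algebra (simplex_space V))) \<and>
        (\<forall>d<D. \<forall>n<N. qz (d, n) \<in> space (prob_algebra (count_space {..<K})))}"

(* KL(q || p).  The library's KL_divergence is a Bochner integral and hence 0 where the
   divergence is infinite, and it takes the reference measure p as its first argument. *)
definition kl_div :: "'a measure \<Rightarrow> 'a measure \<Rightarrow> ereal" where
  "kl_div q p =
     (if absolutely_continuous p q \<and> integrable q (entropy_density (exp 1) p q)
      then ereal (KL_divergence (exp 1) p q) else \<infinity>)"

definition lda_variational_solution :: "real \<Rightarrow> nat \<Rightarrow> nat \<Rightarrow> nat \<Rightarrow> nat \<Rightarrow>
    (nat \<times> nat \<Rightarrow> nat) \<Rightarrow> (lda_param \<times> (nat \<times> nat \<Rightarrow> nat)) measure \<Rightarrow> bool" where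
  "lda_variational_solution c K V D N w q \<longleftrightarrow>
     is_arg_min (\<lambda>q. kl_div q (lda_posterior c K V D N w)) (\<lambda>q. q \<in> mean_field K V D N) q"

definition theta_marginal :: "nat \<Rightarrow> nat \<Rightarrow> nat \<Rightarrow>
    (lda_param \<times> (nat \<times> nat \<Rightarrow> nat)) measure \<Rightarrow> lda_param measure" where
  "theta_marginal K V D q = distr q (lda_param_space K V D) fst"

definition lda_hellinger_risk :: "nat \<Rightarrow> nat \<Rightarrow> nat \<Rightarrow> lda_param \<Rightarrow> lda_param measure \<Rightarrow> real" where
  "lda_hellinger_risk K V D \<theta>s Q =
     (\<integral>\<theta>. (\<Sum>d<D. (hellinger (count_space {..<V}) (word_prob K \<theta> d) (word_prob K \<theta>s d))\<^sup>2)
          / real D \<partial>Q)"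

end

theory Submission
  imports Defs "HOL-Real_Asymp.Real_Asymp"
begin

text \<open>
  Under the truth every word of a document lies in a set of at most \<open>1 / \<delta>0\<^sup>2\<close> words of positive
  probability, so no sieve or test is needed: from \<open>x \<le> exp (2 (sqrt x - 1))\<close> and the
  Cauchy-Schwarz inequality the likelihood ratio of any parameter against the truth is at most
  \<open>exp (2 X - N / 2 * \<Sum>\<^sub>d h\<^sub>d\<^sup>2)\<close>, where \<open>X\<close> sums Pearson's chi-square statistics of the documents
  and has expectation at most \<open>D / \<delta>0\<^sup>2\<close>. The Donsker-Varadhan inequality turns this into a bound of
  the variational risk by the divergence of any competitor in the mean-field family. The
  competitor is the prior conditioned on \<open>x\<^sub>i \<ge> (1 - 1 / N) x\<^sup>*\<^sub>i\<close>, together with the posterior of the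
  assignments under the truth; up to a term of order \<open>D\<close>, its divergence is the negative logarithm of a prior mass, which is
  computed from the Dirichlet density.
\<close>


subsection \<open>The Dirichlet distribution\<close>

text \<open>The likelihood is a product of components of the parameter, so bounding it below near
  the truth takes lower bounds only; components outside the support are free. This gives the
  one-sided neighbourhood. Its relative error 1 / N acts on two factors at each of the D N positions
  and costs \<open>exp (4 * real D)\<close> in total. In the prior mass every support component pays
  about ln N + c ln m, with m the length of the vector, while all components off the support pay
  together for only one such term: a Dirichlet law of total parameter at most 1 concentrates near
  the faces of the simplex. The assignments leave no gap of order D N, because responsibility times
  word probability is again the complete likelihood of the truth at that position, so they cancel
  pointwise. The unknown evidence enters the divergence of the competitor and the exponential moment
  of the loss with opposite signs and drops out. The remaining terms, 4 D and a deviation of at most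
  D ln N with high probability, fit into the rate since a probability vector has a nonempty support,
  whence every e_d is at least 1.\<close>

lemma Gamma_one_plus_le_1:
  assumes "0 \<le> y" "y \<le> (1::real)"
  shows "Gamma (1 + y) \<le> 1"
proof -
  \<comment> \<open>Gamma equals 1 at both 1 and 2, so log-convexity keeps it at most 1 in
    between.\<close>
  have "(ln \<circ> Gamma) ((1 - y) *\<^sub>R 1 + y *\<^sub>R 2) \<le> (1 - y) * (ln \<circ> Gamma) 1 + y * (ln \<circ> Gamma) (2::real)"
    using assms by (intro convex_onD[OF log_convex_Gamma_real]) auto
  moreover have "Gamma (2::real) = 1" using Gamma_fact[of 1, where 'a=real] by (simp add: numeral_2_eq_2)
  ultimately have "ln (Gamma (1 + y)) \<le> 0" by (simp add: algebra_simps)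
  with assms show ?thesis by (simp add: Gamma_real_pos)
qed

text \<open>The point 2 is the convex combination of 1 + y and 2 + y with weights y and 1 - y.
  Log-convexity and the functional equation then give ln Gamma(1 + y) \<ge> - (1 - y) ln(1 + y)
  \<ge> - ln 2.\<close>

lemma Gamma_one_plus_ge_half:
  assumes "0 \<le> y" "y \<le> (1::real)"
  shows "1 / 2 \<le> Gamma (1 + y)"
proof -
  have G2: "Gamma (2::real) = 1" using Gamma_fact[of 1, where 'a=real] by (simp add: numeral_2_eq_2)
  have "(ln \<circ> Gamma) ((1 - (1 - y)) *\<^sub>R (1 + y) + (1 - y) *\<^sub>R (2 + y))
     \<le> (1 - (1 - y)) * (ln \<circ> Gamma) (1 + y) + (1 - y) * (ln \<circ> Gamma) (2 + y)"
    using assms by (intro convex_onD[OF log_convex_Gamma_real]) auto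
  moreover have "(1 - (1 - y)) *\<^sub>R (1 + y) + (1 - y) *\<^sub>R (2 + y) = 2" by (simp add: algebra_simps)
  ultimately have *: "0 \<le> y * ln (Gamma (1 + y)) + (1 - y) * ln (Gamma (2 + y))" using G2 by simp
  have pos: "0 < Gamma (1 + y)" using assms by (simp add: Gamma_real_pos)
  have "Gamma (2 + y) = (1 + y) * Gamma (1 + y)"
    using Gamma_plus1[of "1 + y"] assms by (simp add: add.commute add.left_commute nonpos_Ints_def)
  then have "ln (Gamma (2 + y)) = ln (1 + y) + ln (Gamma (1 + y))" using pos assms by (simp add: ln_mult_pos)
  with * have "0 \<le> ln (Gamma (1 + y)) + (1 - y) * ln (1 + y)" by (simp add: algebra_simps)
  moreover have "(1 - y) * ln (1 + y) \<le> 1 * ln 2" using assms by (intro mult_mono) auto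
  ultimately have "ln (1 / 2) \<le> ln (Gamma (1 + y))" by (simp add: ln_div)
  then show ?thesis using pos by (subst (asm) ln_le_cancel_iff) auto
qed

section \<open>Dirichlet's integral over the corner simplex\<close>

lemma nn_integral_Beta_scaled:
  fixes a b t :: real
  assumes "a > 0" "b > 0" "t \<ge> 0"
  shows "(\<integral>\<^sup>+y. ennreal (y powr (a - 1) * (t - y) powr (b - 1)) * indicator {0..t} y \<partial>lborel)
    = ennreal (t powr (a + b - 1) * Beta a b)"
proof (cases "t = 0")
  case True
  have "(\<integral>\<^sup>+y. ennreal (y powr (a - 1) * (t - y) powr (b - 1)) * indicator {0..t} y \<partial>lborel)
      = (\<integral>\<^sup>+y. 0 \<partial>(lborel :: real measure))"
    by (intro nn_integral_cong) (auto simp: True indicator_def)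
  then show ?thesis by (simp add: True)
next
  case False
  with assms have t: "t > 0" by simp
  have B: "(\<integral>\<^sup>+y. ennreal (y powr (a - 1) * (1 - y) powr (b - 1)) * indicator {0..1} y \<partial>lborel) = ennreal (Beta a b)"
    using nn_integral_has_integral_lebesgue[OF _ has_integral_Beta_real[OF assms(1,2)]]
    by (subst nn_integral_completion[symmetric]) (auto simp: nn_integral_completion mult.commute ennreal_mult' ennreal_indicator[symmetric])
  have "(\<integral>\<^sup>+y. ennreal (y powr (a - 1) * (t - y) powr (b - 1)) * indicator {0..t} y \<partial>lborel)
     = ennreal \<bar>t\<bar> * (\<integral>\<^sup>+u. ennreal ((0 + t * u) powr (a - 1) * (t - (0 + t * u)) powr (b - 1)) * indicator {0..t} (0 + t * u) \<partial>lborel)"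
    using t by (intro nn_integral_real_affine) auto
  also have "(\<integral>\<^sup>+u. ennreal ((0 + t * u) powr (a - 1) * (t - (0 + t * u)) powr (b - 1)) * indicator {0..t} (0 + t * u) \<partial>lborel)
     = (\<integral>\<^sup>+u. ennreal (t powr (a + b - 2)) * (ennreal (u powr (a - 1) * (1 - u) powr (b - 1)) * indicator {0..1} u) \<partial>lborel)"
  proof (intro nn_integral_cong)
    fix u :: real
    have 1: "indicator {0..t} (0 + t * u) = (indicator {0..1} u :: ennreal)"
      using t by (auto simp: indicator_def zero_le_mult_iff)
    have 2: "(t * u) powr (a - 1) * (t - t * u) powr (b - 1)
       = t powr (a + b - 2) * (u powr (a - 1) * (1 - u) powr (b - 1))" if "u \<in> {0..1}"
    proof -
      have "t - t * u = t * (1 - u)" by (simp add: algebra_simps)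
      moreover have "t powr (a + b - 2) = t powr (a - 1) * t powr (b - 1)" by (simp add: powr_add[symmetric])
      ultimately show ?thesis using that t by (simp add: powr_mult)
    qed
    show "ennreal ((0 + t * u) powr (a - 1) * (t - (0 + t * u)) powr (b - 1)) * indicator {0..t} (0 + t * u)
       = ennreal (t powr (a + b - 2)) * (ennreal (u powr (a - 1) * (1 - u) powr (b - 1)) * indicator {0..1} u)"
      unfolding 1 using 2 by (cases "u \<in> {0..1}") (auto simp: ennreal_mult[symmetric])
  qed
  also have "\<dots> = ennreal (t powr (a + b - 2)) * ennreal (Beta a b)"
    by (subst nn_integral_cmult) (auto simp: B)
  also have "ennreal \<bar>t\<bar> * \<dots> = ennreal (t powr (a + b - 1) * Beta a b)"
  proof -
    have "t * t powr (a + b - 2) = t powr (a + b - 1)"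
      using t powr_add[of t 1 "a + b - 2"] by (simp add: algebra_simps)
    then show ?thesis using t by (simp add: ennreal_mult'[symmetric] mult.assoc[symmetric])
  qed
  finally show ?thesis .
qed

lemma corner_simplex_sets:
  fixes m :: nat
  shows "{x \<in> space (Pi\<^sub>M {..<m} (\<lambda>_. lborel :: real measure)). (\<forall>i\<in>{..<m}. 0 \<le> x i) \<and> (\<Sum>i<m. x i) \<le> t}
    \<in> sets (Pi\<^sub>M {..<m} (\<lambda>_. lborel))"
  by (intro sets.sets_Collect_conj sets.sets_Collect_finite_All borel_measurable_le borel_measurable_sum) auto

lemma simplex_integrand_measurable:
  fixes a b t :: real and m :: nat
  shows "(\<lambda>x. ennreal ((\<Prod>i<m. x i powr (a - 1)) * (t - (\<Sum>i<m. x i)) powr (b - 1))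
       * indicator {x. (\<forall>i<m. 0 \<le> x i) \<and> (\<Sum>i<m. x i) \<le> t} x) \<in> borel_measurable (Pi\<^sub>M {..<m} (\<lambda>_. lborel))"
proof (intro borel_measurable_times_ennreal)
  show "(\<lambda>x. ennreal ((\<Prod>i<m. x i powr (a - 1)) * (t - (\<Sum>i<m. x i)) powr (b - 1))) \<in> borel_measurable (Pi\<^sub>M {..<m} (\<lambda>_. lborel))"
    by measurable
  show "indicator {x. (\<forall>i<m. 0 \<le> x i) \<and> (\<Sum>i<m. x i) \<le> t} \<in> borel_measurable (Pi\<^sub>M {..<m} (\<lambda>_. lborel :: real measure))"
    using corner_simplex_sets[of m t]
    by (intro borel_measurable_indicator') (simp add: Ball_def)
qed

text \<open>The size t and the separate exponent b make the induction work: fixing the new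
  coordinate y leaves the same integral over a simplex of size t - y, whose power of t - y meets
  \<open>y powr (a - 1)\<close> in a scaled Beta integral.\<close>

lemma nn_integral_simplex:
  fixes a b t :: real
  assumes "a > 0" "b > 0" "t \<ge> 0"
  shows "(\<integral>\<^sup>+x. ennreal ((\<Prod>i<m. x i powr (a - 1)) * (t - (\<Sum>i<m. x i)) powr (b - 1))
       * indicator {x. (\<forall>i<m. 0 \<le> x i) \<and> (\<Sum>i<m. x i) \<le> t} x \<partial>Pi\<^sub>M {..<m} (\<lambda>_. lborel))
    = ennreal (t powr (real m * a + b - 1) * (Gamma a ^ m * Gamma b / Gamma (real m * a + b)))"
  using assms(3)
proof (induction m arbitrary: t)
  case 0
  interpret product_sigma_finite "\<lambda>_::nat. lborel :: real measure" by unfold_locales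
  show ?case using 0 Gamma_real_pos[OF assms(2)] by (simp add: PiM_empty nn_integral_count_space_finite)
next
  case (Suc m)
  interpret product_sigma_finite "\<lambda>_::nat. lborel :: real measure" by unfold_locales
  let ?c = "Gamma a ^ m * Gamma b / Gamma (real m * a + b)"
  have mab: "0 < real m * a + b" using assms by (simp add: add_nonneg_pos)
  have c0: "0 \<le> ?c" using assms mab by (intro divide_nonneg_nonneg mult_nonneg_nonneg) (auto simp: Gamma_real_pos less_imp_le)
  have "(\<integral>\<^sup>+x. ennreal ((\<Prod>i<Suc m. x i powr (a - 1)) * (t - (\<Sum>i<Suc m. x i)) powr (b - 1))
       * indicator {x. (\<forall>i<Suc m. 0 \<le> x i) \<and> (\<Sum>i<Suc m. x i) \<le> t} x \<partial>Pi\<^sub>M {..<Suc m} (\<lambda>_. lborel))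
     = (\<integral>\<^sup>+y. (\<integral>\<^sup>+x. ennreal ((\<Prod>i<Suc m. (x(m := y)) i powr (a - 1)) * (t - (\<Sum>i<Suc m. (x(m := y)) i)) powr (b - 1))
       * indicator {x. (\<forall>i<Suc m. 0 \<le> x i) \<and> (\<Sum>i<Suc m. x i) \<le> t} (x(m := y)) \<partial>Pi\<^sub>M {..<m} (\<lambda>_. lborel)) \<partial>lborel)"
    by (rule product_nn_integral_insert_rev[of "{..<m}" m, folded lessThan_Suc, OF _ _ simplex_integrand_measurable]) auto
  also have "\<dots> = (\<integral>\<^sup>+y. ennreal ?c * (ennreal (y powr (a - 1) * (t - y) powr (real m * a + b - 1)) * indicator {0..t} y) \<partial>lborel)"
  proof (intro nn_integral_cong)
    fix y :: real
    show "(\<integral>\<^sup>+x. ennreal ((\<Prod>i<Suc m. (x(m := y)) i powr (a - 1)) * (t - (\<Sum>i<Suc m. (x(m := y)) i)) powr (b - 1))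
       * indicator {x. (\<forall>i<Suc m. 0 \<le> x i) \<and> (\<Sum>i<Suc m. x i) \<le> t} (x(m := y)) \<partial>Pi\<^sub>M {..<m} (\<lambda>_. lborel))
      = ennreal ?c * (ennreal (y powr (a - 1) * (t - y) powr (real m * a + b - 1)) * indicator {0..t} y)"
      (is "?L = ?R")
    proof (cases "y \<in> {0..t}")
      case True
      have "?L = (\<integral>\<^sup>+x. ennreal (y powr (a - 1)) * (ennreal ((\<Prod>i<m. x i powr (a - 1)) * ((t - y) - (\<Sum>i<m. x i)) powr (b - 1))
       * indicator {x. (\<forall>i<m. 0 \<le> x i) \<and> (\<Sum>i<m. x i) \<le> t - y} x) \<partial>Pi\<^sub>M {..<m} (\<lambda>_. lborel))"
      proof (intro nn_integral_cong)
        fix x :: "nat \<Rightarrow> real"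
        have i: "indicator {x. (\<forall>i<Suc m. 0 \<le> x i) \<and> (\<Sum>i<Suc m. x i) \<le> t} (x(m := y))
           = (indicator {x. (\<forall>i<m. 0 \<le> x i) \<and> (\<Sum>i<m. x i) \<le> t - y} x :: ennreal)"
          using True by (auto simp: indicator_def less_Suc_eq)
        have p: "(\<Prod>i<m. (x(m := y)) i powr (a - 1)) = (\<Prod>i<m. x i powr (a - 1))"
          and s: "(\<Sum>i<m. (x(m := y)) i) = (\<Sum>i<m. x i)" by (auto intro!: prod.cong sum.cong)
        have e: "(x(m := y)) m = y" "t - ((\<Sum>i<m. x i) + y) = t - y - (\<Sum>i<m. x i)" by auto
        show "ennreal ((\<Prod>i<Suc m. (x(m := y)) i powr (a - 1)) * (t - (\<Sum>i<Suc m. (x(m := y)) i)) powr (b - 1))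
           * indicator {x. (\<forall>i<Suc m. 0 \<le> x i) \<and> (\<Sum>i<Suc m. x i) \<le> t} (x(m := y))
          = ennreal (y powr (a - 1)) * (ennreal ((\<Prod>i<m. x i powr (a - 1)) * ((t - y) - (\<Sum>i<m. x i)) powr (b - 1))
           * indicator {x. (\<forall>i<m. 0 \<le> x i) \<and> (\<Sum>i<m. x i) \<le> t - y} x)"
          unfolding i unfolding prod.lessThan_Suc sum.lessThan_Suc p s e
          by (simp add: ennreal_mult'[symmetric] mult.assoc[symmetric]) (simp add: mult.assoc mult.left_commute)
      qed
      also have "\<dots> = ennreal (y powr (a - 1)) * ennreal ((t - y) powr (real m * a + b - 1) * ?c)"
        using True by (subst nn_integral_cmult[OF simplex_integrand_measurable]) (simp add: Suc.IH)
      also have "\<dots> = ?R" using True c0 by (simp add: ennreal_mult[symmetric] ennreal_mult'[symmetric] mult_ac)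
      finally show ?thesis .
    next
      case False
      have "?L = (\<integral>\<^sup>+x. 0 \<partial>Pi\<^sub>M {..<m} (\<lambda>_. lborel :: real measure))"
      proof (intro nn_integral_cong)
        fix x :: "nat \<Rightarrow> real"
        have "\<not> ((\<forall>i<Suc m. 0 \<le> (x(m := y)) i) \<and> (\<Sum>i<Suc m. (x(m := y)) i) \<le> t)"
        proof
          assume *: "(\<forall>i<Suc m. 0 \<le> (x(m := y)) i) \<and> (\<Sum>i<Suc m. (x(m := y)) i) \<le> t"
          then have "0 \<le> y" by (auto dest: spec[of _ m])
          moreover have "0 \<le> (\<Sum>i<m. (x(m := y)) i)" using * by (intro sum_nonneg) (metis less_SucI lessThan_iff)
          ultimately show False using * False by auto
        qed
        then show "ennreal ((\<Prod>i<Suc m. (x(m := y)) i powr (a - 1)) * (t - (\<Sum>i<Suc m. (x(m := y)) i)) powr (b - 1))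
           * indicator {x. (\<forall>i<Suc m. 0 \<le> x i) \<and> (\<Sum>i<Suc m. x i) \<le> t} (x(m := y)) = 0"
          by (simp add: indicator_def)
      qed
      then show ?thesis using False by simp
    qed
  qed
  also have "\<dots> = ennreal ?c * ennreal (t powr (a + (real m * a + b) - 1) * Beta a (real m * a + b))"
    using nn_integral_Beta_scaled[OF assms(1) mab Suc.prems]
    by (subst nn_integral_cmult) auto
  also have "\<dots> = ennreal (t powr (real (Suc m) * a + b - 1) * (Gamma a ^ Suc m * Gamma b / Gamma (real (Suc m) * a + b)))"
  proof -
    have e: "a + (real m * a + b) = real (Suc m) * a + b" by (simp add: algebra_simps)
    have "?c * (t powr (a + (real m * a + b) - 1) * Beta a (real m * a + b))
        = t powr (real (Suc m) * a + b - 1) * (Gamma a ^ Suc m * Gamma b / Gamma (real (Suc m) * a + b))"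
      unfolding Beta_def e using Gamma_real_pos[OF mab] by (simp del: of_nat_Suc)
    then show ?thesis by (simp only: ennreal_mult'[OF c0, symmetric])
  qed
  finally show ?case .
qed

section \<open>The simplex, its chart and the Dirichlet law\<close>

lemma prob_simplex_le_1: "x \<in> prob_simplex m \<Longrightarrow> i < m \<Longrightarrow> x i \<le> 1"
  using member_le_sum[of i "{..<m}" x] by (auto simp: prob_simplex_def)

lemma simplex_chart_in_simplex:
  assumes "0 < m" "x \<in> simplex_chart_dom m"
  shows "simplex_chart m x \<in> prob_simplex m"
proof -
  obtain n where m: "m = Suc n" using assms(1) by (cases m) auto
  have "(\<Sum>i<n. simplex_chart m x i) = (\<Sum>i<n. x i)"
    by (intro sum.cong) (auto simp: simplex_chart_def m)
  then have "(\<Sum>i<m. simplex_chart m x i) = 1" by (simp add: m simplex_chart_def)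
  then show ?thesis using assms(2)
    by (auto simp: prob_simplex_def simplex_chart_dom_def simplex_chart_def m)
qed

lemma prob_simplex_nonempty: "0 < m \<Longrightarrow> \<exists>i<m. x i \<noteq> 0" if "x \<in> prob_simplex m"
proof (rule ccontr)
  assume "\<not> (\<exists>i<m. x i \<noteq> 0)"
  then have "(\<Sum>i<m. x i) = 0" by (intro sum.neutral) auto
  then show False using that by (simp add: prob_simplex_def)
qed

lemma space_simplex_space: "space (simplex_space m) = prob_simplex m"
  by (auto simp: simplex_space_def space_restrict_space space_PiM prob_simplex_def PiE_def)

text \<open>For i \<ge> m all points of the simplex take the value \<open>undefined\<close>, so the
  component is constant; later measurability goals then carry no bound on the index.\<close>

lemma simplex_space_component [measurable]:
  "(\<lambda>x. x i) \<in> borel_measurable (simplex_space m)"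
proof (cases "i < m")
  case True
  then show ?thesis unfolding simplex_space_def by (intro measurable_restrict_space1) simp
next
  case False
  have "(\<lambda>x. x i) \<in> borel_measurable (simplex_space m) \<longleftrightarrow> (\<lambda>x. undefined :: real) \<in> borel_measurable (simplex_space m)"
    using False by (intro measurable_cong) (auto simp: space_simplex_space prob_simplex_def extensional_def)
  then show ?thesis by simp
qed

lemma simplex_chart_dom_sets [measurable]:
  "simplex_chart_dom m \<inter> space (Pi\<^sub>M {..<m - 1} (\<lambda>_. lborel)) \<in> sets (Pi\<^sub>M {..<m - 1} (\<lambda>_. lborel))"
proof -
  note corner_simplex_sets[of "m - 1" 1]
  also have "{x \<in> space (Pi\<^sub>M {..<m - 1} (\<lambda>_. lborel :: real measure)). (\<forall>i\<in>{..<m - 1}. 0 \<le> x i) \<and> (\<Sum>i<m - 1. x i) \<le> 1}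
    = simplex_chart_dom m \<inter> space (Pi\<^sub>M {..<m - 1} (\<lambda>_. lborel))"
    by (auto simp: simplex_chart_dom_def)
  finally show ?thesis .
qed

lemma simplex_chart_measurable:
  "(\<lambda>x. simplex_chart m x i) \<in> borel_measurable (Pi\<^sub>M {..<m - 1} (\<lambda>_. lborel))"
proof -
  have c: "(\<lambda>x. x j) \<in> borel_measurable (Pi\<^sub>M {..<m - 1} (\<lambda>_. lborel :: real measure))" if "j < m - 1" for j
    using that measurable_component_singleton[of j "{..<m - 1}" "\<lambda>_. lborel :: real measure"]
    by (simp del: One_nat_def)
  consider "i < m - 1" | "\<not> i < m - 1" "i < m" | "\<not> i < m" by blast
  then show ?thesis
  proof cases
    case 1
    then have "(\<lambda>x. simplex_chart m x i) = (\<lambda>x. x i)" by (auto simp: simplex_chart_def fun_eq_iff)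
    with c[OF 1] show ?thesis by simp
  next
    case 2
    have "(\<lambda>x. 1 - (\<Sum>j<m - 1. x j)) \<in> borel_measurable (Pi\<^sub>M {..<m - 1} (\<lambda>_. lborel :: real measure))"
      using c by (intro borel_measurable_diff borel_measurable_sum) auto
    with 2 show ?thesis by (simp add: simplex_chart_def)
  qed (simp add: simplex_chart_def)
qed

lemma simplex_chart_measurable_simplex:
  assumes "0 < m"
  shows "simplex_chart m \<in> measurable (restrict_space (Pi\<^sub>M {..<m - 1} (\<lambda>_. lborel)) (simplex_chart_dom m)) (simplex_space m)"
  unfolding simplex_space_def
proof (intro measurable_restrict_space2)
  show "simplex_chart m \<in> space (restrict_space (Pi\<^sub>M {..<m - 1} (\<lambda>_. lborel)) (simplex_chart_dom m)) \<rightarrow> prob_simplex m"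
    using simplex_chart_in_simplex[OF assms] by (auto simp: space_restrict_space)
  have "simplex_chart m \<in> measurable (Pi\<^sub>M {..<m - 1} (\<lambda>_. lborel)) (Pi\<^sub>M {..<m} (\<lambda>_. borel))"
    by (rule measurable_PiM_single'[OF simplex_chart_measurable])
      (simp add: simplex_chart_def space_PiM PiE_iff Pi_iff extensional_def)
  then show "simplex_chart m \<in> measurable (restrict_space (Pi\<^sub>M {..<m - 1} (\<lambda>_. lborel)) (simplex_chart_dom m)) (Pi\<^sub>M {..<m} (\<lambda>_. borel))"
    by (rule measurable_restrict_space1)
qed

lemma emeasure_dirichlet:
  assumes "0 < m" "A \<in> sets (simplex_space m)"
  shows "emeasure (dirichlet m a) A =
    (\<integral>\<^sup>+x. ennreal (dirichlet_density m a (simplex_chart m x)) * indicator A (simplex_chart m x)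
       * indicator (simplex_chart_dom m) x \<partial>Pi\<^sub>M {..<m - 1} (\<lambda>_. lborel))"
proof -
  let ?P = "Pi\<^sub>M {..<m - 1} (\<lambda>_. lborel :: real measure)"
  let ?R = "restrict_space ?P (simplex_chart_dom m)"
  have dm: "(\<lambda>x. ennreal (dirichlet_density m a (simplex_chart m x))) \<in> borel_measurable ?R"
    unfolding dirichlet_density_def
    by (intro measurable_restrict_space1 measurable_compose[OF _ measurable_ennreal] borel_measurable_times borel_measurable_prod
        powr_real_measurable borel_measurable_const simplex_chart_measurable)
  have pre: "simplex_chart m -` A \<inter> space ?R \<in> sets ?R"
    using measurable_sets[OF simplex_chart_measurable_simplex[OF assms(1)] assms(2)] .
  have "emeasure (dirichlet m a) A = emeasure (density ?R (\<lambda>x. ennreal (dirichlet_density m a (simplex_chart m x)))) (simplex_chart m -` A \<inter> space ?R)"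
    unfolding dirichlet_def
    using assms simplex_chart_measurable_simplex[OF assms(1)] by (subst emeasure_distr) auto
  also have "\<dots> = (\<integral>\<^sup>+x. ennreal (dirichlet_density m a (simplex_chart m x)) * indicator (simplex_chart m -` A \<inter> space ?R) x \<partial>?R)"
    using dm pre by (rule emeasure_density)
  also have "\<dots> = (\<integral>\<^sup>+x. ennreal (dirichlet_density m a (simplex_chart m x)) * indicator A (simplex_chart m x) \<partial>?R)"
    by (intro nn_integral_cong) (auto simp: indicator_def)
  finally show ?thesis
    unfolding nn_integral_restrict_space[OF simplex_chart_dom_sets] .
qed

lemma sets_dirichlet [measurable_cong, simp]: "sets (dirichlet m a) = sets (simplex_space m)"
  by (simp add: dirichlet_def)

lemma space_dirichlet [simp]: "space (dirichlet m a) = prob_simplex m"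
  by (simp add: dirichlet_def space_simplex_space)

lemma dirichlet_density_chart:
  assumes "0 < m"
  shows "dirichlet_density m a (simplex_chart m x) =
    Gamma (real m * a) / Gamma a ^ m * ((\<Prod>i<m - 1. x i powr (a - 1)) * (1 - (\<Sum>i<m - 1. x i)) powr (a - 1))"
proof -
  obtain n where m: "m = Suc n" using assms(1) by (cases m) auto
  have "(\<Prod>i<n. simplex_chart m x i powr (a - 1)) = (\<Prod>i<n. x i powr (a - 1))"
    by (intro prod.cong) (auto simp: simplex_chart_def m)
  then show ?thesis by (simp add: dirichlet_density_def m simplex_chart_def)
qed

text \<open>The normalising constant is Dirichlet's integral in m - 1 coordinates with t = 1 and b =
  a.\<close>

lemma prob_space_dirichlet:
  assumes "0 < m" "0 < a"
  shows "prob_space (dirichlet m a)"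
proof
  let ?P = "Pi\<^sub>M {..<m - 1} (\<lambda>_. lborel :: real measure)"
  let ?c = "Gamma (real m * a) / Gamma a ^ m"
  have g: "0 < Gamma (real m * a)" "0 < Gamma a" using assms by (auto simp: Gamma_real_pos)
  have c: "0 \<le> ?c" using g by simp
  have "emeasure (dirichlet m a) (space (dirichlet m a)) =
     (\<integral>\<^sup>+x. ennreal (dirichlet_density m a (simplex_chart m x)) * indicator (prob_simplex m) (simplex_chart m x)
       * indicator (simplex_chart_dom m) x \<partial>?P)"
    using assms by (subst emeasure_dirichlet) (auto simp: space_simplex_space[symmetric])
  also have "\<dots> = (\<integral>\<^sup>+x. ennreal ?c * (ennreal ((\<Prod>i<m - 1. x i powr (a - 1)) * (1 - (\<Sum>i<m - 1. x i)) powr (a - 1))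
       * indicator {x. (\<forall>i<m - 1. 0 \<le> x i) \<and> (\<Sum>i<m - 1. x i) \<le> 1} x) \<partial>?P)"
  proof (intro nn_integral_cong)
    fix x :: "nat \<Rightarrow> real"
    show "ennreal (dirichlet_density m a (simplex_chart m x)) * indicator (prob_simplex m) (simplex_chart m x)
       * indicator (simplex_chart_dom m) x
      = ennreal ?c * (ennreal ((\<Prod>i<m - 1. x i powr (a - 1)) * (1 - (\<Sum>i<m - 1. x i)) powr (a - 1))
       * indicator {x. (\<forall>i<m - 1. 0 \<le> x i) \<and> (\<Sum>i<m - 1. x i) \<le> 1} x)"
      using simplex_chart_in_simplex[OF assms(1), of x] c
      by (auto simp: indicator_def dirichlet_density_chart[OF assms(1)] ennreal_mult'[symmetric] simplex_chart_dom_def)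
  qed
  also have "\<dots> = ennreal ?c * ennreal (1 powr (real (m - 1) * a + a - 1) * (Gamma a ^ (m - 1) * Gamma a / Gamma (real (m - 1) * a + a)))"
    using assms
    by (subst nn_integral_cmult[OF simplex_integrand_measurable]) (simp add: nn_integral_simplex)
  also have "\<dots> = 1"
  proof -
    have "real (m - 1) * a + a = real m * a" using assms by (simp add: of_nat_diff algebra_simps)
    moreover have "Gamma a ^ (m - 1) * Gamma a = Gamma a ^ m" by (rule power_minus_mult[OF assms(1)])
    ultimately show ?thesis using g by (simp add: ennreal_mult'[symmetric])
  qed
  finally show "emeasure (dirichlet m a) (space (dirichlet m a)) = 1" .
qed

section \<open>Dirichlet mass of a one-sided neighbourhood of a sparse vector\<close>

lemma nn_integral_powr_ge:
  fixes a t :: real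
  assumes "0 < a" "0 \<le> t"
  shows "ennreal (t powr a / a) \<le> (\<integral>\<^sup>+y. ennreal (y powr (a - 1)) * indicator {0..t} y \<partial>lborel)"
proof -
  have "Gamma (a + 1) = a * Gamma a" using assms by (intro Gamma_plus1) (auto simp: nonpos_Ints_def)
  then have "Beta a 1 = 1 / a" using Gamma_real_pos[OF assms(1)] by (simp add: Beta_def)
  then have "ennreal (t powr a / a) = (\<integral>\<^sup>+y. ennreal (y powr (a - 1) * (t - y) powr (1 - 1)) * indicator {0..t} y \<partial>lborel)"
    using assms by (subst nn_integral_Beta_scaled) auto
  \<comment> \<open>\<open>(t - y) powr 0\<close> is 1 except at y = t, where it is 0; hence an
    inequality between the integrands.\<close>
  also have "\<dots> \<le> (\<integral>\<^sup>+y. ennreal (y powr (a - 1)) * indicator {0..t} y \<partial>lborel)"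
    by (intro nn_integral_mono mult_right_mono ennreal_leI) auto
  finally show ?thesis .
qed

text \<open>Write Gamma(y) = Gamma(1 + y) / y and use the two bounds for Gamma on [1, 2] at y = m a
  and y = a. The factor \<open>a ^ (m - 1)\<close> is kept because it cancels the 1 / a that each
  off-support coordinate produces on integration.\<close>

lemma dirichlet_normalizer_ge:
  assumes "0 < m" "0 < a" "real m * a \<le> 1"
  shows "a ^ (m - 1) / (2 * real m) \<le> Gamma (real m * a) / Gamma a ^ m"
proof -
  have ma: "0 < real m * a" using assms by simp
  have "1 * a \<le> real m * a" using assms by (intro mult_right_mono) auto
  with assms have a1: "a \<le> 1" by linarith
  have "Gamma (1 + real m * a) = real m * a * Gamma (real m * a)"
    using ma Gamma_plus1[of "real m * a"] by (simp add: add.commute nonpos_Ints_def)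
  with Gamma_one_plus_ge_half[of "real m * a"] ma assms have 1: "1 / (2 * (real m * a)) \<le> Gamma (real m * a)"
    by (simp add: field_simps)
  have "Gamma (1 + a) = a * Gamma a"
    using assms Gamma_plus1[of a] by (simp add: add.commute nonpos_Ints_def)
  with Gamma_one_plus_le_1[of a] assms a1 have "Gamma a \<le> 1 / a" by (simp add: field_simps)
  moreover have ga: "0 < Gamma a" using assms by (simp add: Gamma_real_pos)
  ultimately have "Gamma a ^ m \<le> (1 / a) ^ m" by (intro power_mono) auto
  with ga have 2: "1 / (1 / a) ^ m \<le> 1 / Gamma a ^ m" by (intro divide_left_mono) (use assms in auto)
  have "a ^ (m - 1) / (2 * real m) = 1 / (2 * (real m * a)) * (1 / (1 / a) ^ m)"
  proof -
    have "1 / (1 / a) ^ m = a * a ^ (m - 1)"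
      using power_minus_mult[OF assms(1), of a] by (simp add: power_divide mult.commute)
    then show ?thesis using assms(1,2) by simp
  qed
  also have "\<dots> \<le> Gamma (real m * a) * (1 / Gamma a ^ m)"
    using 1 2 ma assms ga by (intro mult_mono) (auto simp: Gamma_real_pos less_imp_le)
  finally show ?thesis by simp
qed

text \<open>A relative, one-sided neighbourhood: it constrains only the support of
  \<open>xs\<close>, and it suffices for bounding a product of components from below.\<close>

definition lower_box :: "nat \<Rightarrow> real \<Rightarrow> (nat \<Rightarrow> real) \<Rightarrow> (nat \<Rightarrow> real) set" where
  "lower_box m \<eta> xs = {x \<in> prob_simplex m. \<forall>i<m. (1 - \<eta>) * xs i \<le> x i}"

lemma lower_box_sets: "lower_box m \<eta> xs \<in> sets (simplex_space m)"
proof -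
  have "{x \<in> space (simplex_space m). \<forall>i\<in>{..<m}. (1 - \<eta>) * xs i \<le> x i} \<in> sets (simplex_space m)"
    by (intro sets.sets_Collect_finite_All borel_measurable_le borel_measurable_const simplex_space_component) auto
  also have "{x \<in> space (simplex_space m). \<forall>i\<in>{..<m}. (1 - \<eta>) * xs i \<le> x i} = lower_box m \<eta> xs"
    by (auto simp: lower_box_def space_simplex_space)
  finally show ?thesis .
qed

text \<open>Lowering every support coordinate of the chart by between \<open>\<eta> \<delta> / 2\<close> and \<open>\<eta> \<delta>\<close> leaves room for
  the off-support coordinates and keeps the last coordinate large enough, whether or not it belongs
  to the support.\<close>

lemma lower_box_chart:
  fixes \<delta> \<eta> :: real
  assumes m: "0 < m" and xs: "xs \<in> prob_simplex m" "\<And>i. i < m \<Longrightarrow> xs i \<noteq> 0 \<Longrightarrow> \<delta> \<le> xs i"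
    and \<delta>: "0 < \<delta>" and \<eta>: "0 < \<eta>" "\<eta> < 1"
    and on: "\<And>i. i < m - 1 \<Longrightarrow> xs i \<noteq> 0 \<Longrightarrow> x i \<in> {xs i - \<eta> * \<delta> .. xs i - \<eta> * \<delta> / 2}"
    and off: "\<And>i. i < m - 1 \<Longrightarrow> xs i = 0 \<Longrightarrow> x i \<in> {0 .. \<eta> * \<delta> / (2 * real m)}"
  shows "x \<in> simplex_chart_dom m" "simplex_chart m x \<in> lower_box m \<eta> xs"
    "0 < 1 - (\<Sum>i<m - 1. x i)" "\<And>i. i < m - 1 \<Longrightarrow> 0 \<le> x i \<and> (xs i \<noteq> 0 \<longrightarrow> 0 < x i)"
proof -
  let ?r = "\<eta> * \<delta>"
  obtain n where n: "m = Suc n" using m by (cases m) auto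
  have r: "0 < ?r" using \<delta> \<eta> by simp
  have nn: "0 \<le> xs i" if "i < m" for i using that xs(1) by (simp add: prob_simplex_def)
  have sum1: "(\<Sum>i<n. xs i) + xs n = 1" using xs(1) by (simp add: prob_simplex_def n)
  have low: "(1 - \<eta>) * xs i \<le> x i" if "i < n" for i
  proof (cases "xs i = 0")
    case False
    then have "\<eta> * \<delta> \<le> \<eta> * xs i" using xs(2)[of i] that \<eta> by (simp add: n)
    with on[of i] False that show ?thesis by (simp add: n algebra_simps)
  qed (use off[of i] that in \<open>simp add: n\<close>)
  have pos: "0 \<le> x i \<and> (xs i \<noteq> 0 \<longrightarrow> 0 < x i)" if "i < n" for i
  proof -
    have "0 < (1 - \<eta>) * xs i" if "xs i \<noteq> 0" using \<eta> that nn[of i] \<open>i < n\<close> by (simp add: n)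
    then show ?thesis using low[OF that] off[of i] that by (fastforce simp: n)
  qed
  have up: "x i \<le> xs i + ?r / (2 * real m) - (if xs i \<noteq> 0 then ?r / 2 else 0)" if "i < n" for i
    using on[of i] off[of i] that r by (auto simp: n intro: order_trans)
  \<comment> \<open>All off-support coordinates together take less than half of
    \<open>\<eta> * \<delta>\<close>, which is what lowering one support coordinate
    releases.\<close>
  have "real n * (?r / (2 * real m)) < ?r / 2"
    using r by (simp add: n field_simps)
  moreover have "(\<Sum>i<n. x i) \<le> (\<Sum>i<n. xs i + ?r / (2 * real m) - (if xs i \<noteq> 0 then ?r / 2 else 0))"
    using up by (intro sum_mono) auto
  moreover have "(\<Sum>i<n. xs i + ?r / (2 * real m) - (if xs i \<noteq> 0 then ?r / 2 else 0))
     = (\<Sum>i<n. xs i) + real n * (?r / (2 * real m)) - (\<Sum>i<n. (if xs i \<noteq> 0 then ?r / 2 else 0))"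
    by (simp add: sum.distrib sum_subtractf)
  ultimately have S: "(\<Sum>i<n. x i) < (\<Sum>i<n. xs i) + ?r / 2 - (\<Sum>i<n. (if xs i \<noteq> 0 then ?r / 2 else 0))"
    by linarith
  \<comment> \<open>If the last coordinate is off the support, some other coordinate is in it and
    pays for the off-support mass. Otherwise the last coordinate is at least \<delta> and has its
    own slack of \<open>\<eta> * \<delta>\<close>, half of which is enough.\<close>
  have last: "0 < 1 - (\<Sum>i<n. x i) \<and> (1 - \<eta>) * xs n \<le> 1 - (\<Sum>i<n. x i)"
  proof (cases "xs n = 0")
    case True
    obtain j where j: "j < m" "xs j \<noteq> 0" using prob_simplex_nonempty[OF xs(1) m] by blast
    with True have "j < n" using n less_Suc_eq by auto
    then have "(if xs j \<noteq> 0 then ?r / 2 else 0) \<le> (\<Sum>i<n. (if xs i \<noteq> 0 then ?r / 2 else 0))"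
      using r by (intro member_le_sum) auto
    then show ?thesis using S sum1 True j by auto
  next
    case False
    then have "\<eta> * \<delta> \<le> \<eta> * xs n" using xs(2)[of n] \<eta> by (simp add: n)
    moreover have "0 < (1 - \<eta>) * xs n" using False nn[of n] \<eta> by (simp add: n)
    moreover have "0 \<le> (\<Sum>i<n. (if xs i \<noteq> 0 then ?r / 2 else 0))" using r by (intro sum_nonneg) auto
    ultimately show ?thesis using S sum1 r by (auto simp: algebra_simps)
  qed
  show dom: "x \<in> simplex_chart_dom m" using last pos by (auto simp: simplex_chart_dom_def n)
  show "simplex_chart m x \<in> lower_box m \<eta> xs"
    using simplex_chart_in_simplex[OF m dom] low last
    by (auto simp: lower_box_def simplex_chart_def n less_Suc_eq)
  show "0 < 1 - (\<Sum>i<m - 1. x i)" using last by (simp add: n)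
  show "\<And>i. i < m - 1 \<Longrightarrow> 0 \<le> x i \<and> (xs i \<noteq> 0 \<longrightarrow> 0 < x i)" using pos by (simp add: n)
qed

text \<open>The box contains a product set in the chart, so the integral splits. Since a \<le> 1, a
  density factor on the support is at least 1, and an off-support coordinate integrates to
  \<open>t powr a / a\<close> with t = \<eta> \<delta> / (2 m). The factor
  \<open>a ^ (m - 1)\<close> of the normaliser removes every 1 / a and leaves one a per support
  coordinate. Finally m a \<le> 1 bounds the product of all the \<open>t powr a\<close> below by a
  single t: this is where sparsity is rewarded.\<close>

lemma dirichlet_lower_box_ge:
  fixes \<delta> \<eta> a :: real
  assumes m: "0 < m" and a: "0 < a" "real m * a \<le> 1"
    and xs: "xs \<in> prob_simplex m" "\<And>i. i < m \<Longrightarrow> xs i \<noteq> 0 \<Longrightarrow> \<delta> \<le> xs i"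
    and \<delta>: "0 < \<delta>" and \<eta>: "0 < \<eta>" "\<eta> < 1"
  shows "ennreal (1 / (2 * real m) * (a * (\<eta> * \<delta>) / 2) ^ card {i. i < m \<and> xs i \<noteq> 0} * (\<eta> * \<delta> / (2 * real m)))
    \<le> emeasure (dirichlet m a) (lower_box m \<eta> xs)"
proof -
  interpret product_sigma_finite "\<lambda>_::nat. lborel :: real measure" by unfold_locales
  let ?P = "Pi\<^sub>M {..<m - 1} (\<lambda>_. lborel :: real measure)"
  let ?r = "\<eta> * \<delta>"
  let ?t = "?r / (2 * real m)"
  let ?c = "Gamma (real m * a) / Gamma a ^ m"
  \<comment> \<open>\<open>g i\<close> is a minorant of the i-th density factor that vanishes off
    the product set; \<open>h i\<close> is a lower bound for its integral.\<close>
  define g where "g i y = (if xs i \<noteq> 0 then indicator {xs i - ?r .. xs i - ?r / 2} y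
      else ennreal (y powr (a - 1)) * indicator {0..?t} y)" for i and y :: real
  define h where "h i = (if xs i \<noteq> 0 then ?r / 2 else ?t powr a / a)" for i
  have r: "0 < ?r" using \<delta> \<eta> by simp
  have "1 * a \<le> real m * a" using a m by (intro mult_right_mono) auto
  with a have a1: "a \<le> 1" by linarith
  obtain j where "j < m" "xs j \<noteq> 0" using prob_simplex_nonempty[OF xs(1) m] by blast
  then have "\<delta> \<le> 1" using xs(2)[of j] prob_simplex_le_1[OF xs(1), of j] by simp
  with \<delta> \<eta> have r1: "?r \<le> 1" by (simp add: mult_le_one)
  have c: "0 \<le> ?c" using a m by (simp add: Gamma_real_pos less_imp_le)
  have gm [measurable]: "g i \<in> borel_measurable lborel" for i
    unfolding g_def by (cases "xs i = 0") auto
  have h0: "0 \<le> h i" for i using r a by (simp add: h_def)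
  have hg: "ennreal (h i) \<le> (\<integral>\<^sup>+y. g i y \<partial>lborel)" for i
  proof (cases "xs i = 0")
    case True
    then show ?thesis using nn_integral_powr_ge[of a ?t] a r by (simp add: h_def g_def)
  next
    case False
    have "emeasure lborel {xs i - ?r .. xs i - ?r / 2} = ennreal ((xs i - ?r / 2) - (xs i - ?r))"
      using less_imp_le[OF r] by (intro emeasure_lborel_Icc) linarith
    also have "(xs i - ?r / 2) - (xs i - ?r) = h i" using False by (simp add: h_def)
    finally show ?thesis using False by (simp add: g_def)
  qed
  have "ennreal (?c * (\<Prod>i<m - 1. h i)) = ennreal ?c * (\<Prod>i<m - 1. ennreal (h i))"
    unfolding ennreal_mult'[OF c] by (subst prod_ennreal) (auto simp: h0)
  also have "\<dots> \<le> ennreal ?c * (\<Prod>i<m - 1. \<integral>\<^sup>+y. g i y \<partial>lborel)"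
    using hg by (intro mult_left_mono prod_mono_ennreal) auto
  also have "(\<Prod>i<m - 1. \<integral>\<^sup>+y. g i y \<partial>lborel) = (\<integral>\<^sup>+x. (\<Prod>i<m - 1. g i (x i)) \<partial>?P)"
    by (subst product_nn_integral_prod) auto
  also have "ennreal ?c * \<dots> = (\<integral>\<^sup>+x. ennreal ?c * (\<Prod>i<m - 1. g i (x i)) \<partial>?P)"
    by (subst nn_integral_cmult) auto
  also have "\<dots> \<le> (\<integral>\<^sup>+x. ennreal (dirichlet_density m a (simplex_chart m x)) * indicator (lower_box m \<eta> xs) (simplex_chart m x)
       * indicator (simplex_chart_dom m) x \<partial>?P)"
  proof (intro nn_integral_mono)
    fix x :: "nat \<Rightarrow> real"
    let ?R = "ennreal (dirichlet_density m a (simplex_chart m x)) * indicator (lower_box m \<eta> xs) (simplex_chart m x)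
       * indicator (simplex_chart_dom m) x"
    show "ennreal ?c * (\<Prod>i<m - 1. g i (x i)) \<le> ?R"
    proof (cases "\<forall>i<m - 1. x i \<in> (if xs i \<noteq> 0 then {xs i - ?r .. xs i - ?r / 2} else {0 .. ?t})")
      case False
      then obtain i where "i < m - 1" "g i (x i) = 0" by (auto simp: g_def split: if_splits)
      then have z: "(\<Prod>i<m - 1. g i (x i)) = 0" by (intro prod_zero) auto
      show ?thesis unfolding z by simp
    next
      case True
      have *: "x i \<in> {xs i - ?r .. xs i - ?r / 2}" if "i < m - 1" "xs i \<noteq> 0" for i using True that by auto
      have **: "x i \<in> {0 .. ?t}" if "i < m - 1" "xs i = 0" for i using True that by auto
      have L: "x \<in> simplex_chart_dom m" "simplex_chart m x \<in> lower_box m \<eta> xs" "0 < 1 - (\<Sum>i<m - 1. x i)"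
        using lower_box_chart[of m xs \<delta> \<eta> x] m xs \<delta> \<eta> * ** by blast+
      have L4: "0 \<le> x i \<and> (xs i \<noteq> 0 \<longrightarrow> 0 < x i)" if "i < m - 1" for i
        using lower_box_chart[of m xs \<delta> \<eta> x] m xs \<delta> \<eta> * ** that by blast
      have geone: "1 \<le> y powr (a - 1)" if "0 < y" "y \<le> 1" for y :: real
        using that a1 powr_mono'[of "a - 1" 0 y] by simp
      have gi: "g i (x i) \<le> ennreal (x i powr (a - 1))" if "i < m - 1" for i
      proof (cases "xs i = 0")
        case False
        have "xs i \<le> 1" using prob_simplex_le_1[OF xs(1), of i] that by simp
        moreover have "x i \<le> xs i - ?r / 2" using *[OF that False] by simp
        ultimately have "x i \<le> 1" using r by linarith
        then have "1 \<le> x i powr (a - 1)" using L4[OF that] False by (intro geone) auto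
        then show ?thesis using False by (auto simp: g_def indicator_def)
      qed (auto simp: g_def indicator_def)
      have "0 \<le> (\<Sum>i<m - 1. x i)" using L4 by (intro sum_nonneg) auto
      then have "1 \<le> (1 - (\<Sum>i<m - 1. x i)) powr (a - 1)" using L(3) by (intro geone) auto
      then have "(\<Prod>i<m - 1. x i powr (a - 1)) * 1 \<le> (\<Prod>i<m - 1. x i powr (a - 1)) * (1 - (\<Sum>i<m - 1. x i)) powr (a - 1)"
        by (intro mult_left_mono) (auto intro: prod_nonneg)
      then have D: "?c * (\<Prod>i<m - 1. x i powr (a - 1)) \<le> dirichlet_density m a (simplex_chart m x)"
        using c unfolding dirichlet_density_chart[OF m] by (intro mult_left_mono) auto
      have "ennreal ?c * (\<Prod>i<m - 1. g i (x i)) \<le> ennreal ?c * (\<Prod>i<m - 1. ennreal (x i powr (a - 1)))"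
        using gi by (intro mult_left_mono prod_mono_ennreal) auto
      also have "\<dots> = ennreal (?c * (\<Prod>i<m - 1. x i powr (a - 1)))"
        unfolding ennreal_mult'[OF c] by (subst prod_ennreal) auto
      also have "\<dots> \<le> ?R" using L(1,2) D by (simp add: ennreal_leI)
      finally show ?thesis .
    qed
  qed
  also have "\<dots> = emeasure (dirichlet m a) (lower_box m \<eta> xs)"
    using m by (simp add: emeasure_dirichlet lower_box_sets)
  finally have main: "ennreal (?c * (\<Prod>i<m - 1. h i)) \<le> emeasure (dirichlet m a) (lower_box m \<eta> xs)" .
  \<comment> \<open>The chart integrates over m - 1 coordinates only, so the exponent obtained is
    \<open>?s'\<close>; it differs from \<open>?s\<close> when the last coordinate is in the
    support. As the base is at most 1, passing to the larger \<open>?s\<close> only weakens the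
    bound.\<close>
  let ?s = "card {i. i < m \<and> xs i \<noteq> 0}" and ?s' = "card {i. i < m - 1 \<and> xs i \<noteq> 0}"
  have ar: "0 \<le> a * ?r / 2" "a * ?r / 2 \<le> 1" using a1 a r r1 mult_le_one[of a ?r] by auto
  have t: "0 < ?t" "?t \<le> 1" using r r1 m by (auto simp: field_simps intro: order_trans)
  have "(a * ?r / 2) ^ ?s \<le> (a * ?r / 2) ^ ?s'"
    using ar by (intro power_decreasing card_mono) auto
  also have "(a * ?r / 2) ^ ?s' = (\<Prod>i<m - 1. if xs i \<noteq> 0 then a * ?r / 2 else 1)"
    by (subst prod.If_cases) (auto intro!: arg_cong2[where f="(^)"] arg_cong[where f=card])
  finally have p1: "(a * ?r / 2) ^ ?s \<le> (\<Prod>i<m - 1. if xs i \<noteq> 0 then a * ?r / 2 else 1)" .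
  have pw: "u powr (a * real (m - 1)) = (\<Prod>i<m - 1. u powr a)" if "0 < u" for u
    using that by (simp add: powr_powr[symmetric] powr_realpow)
  have "?t = ?t powr 1" by (rule powr_one[OF less_imp_le[OF t(1)], symmetric])
  also have "\<dots> \<le> ?t powr (a * real (m - 1))"
    using t a m by (intro powr_mono') (auto simp: of_nat_diff algebra_simps)
  also have "\<dots> = (\<Prod>i<m - 1. ?t powr a)" by (rule pw[OF t(1)])
  also have "\<dots> \<le> (\<Prod>i<m - 1. if xs i \<noteq> 0 then 1 else ?t powr a)"
  proof (intro prod_mono conjI)
    show "?t powr a \<le> (if xs i \<noteq> 0 then 1 else ?t powr a)" for i
      using powr_le1[of a ?t] t a by simp
  qed simp
  finally have p2: "?t \<le> (\<Prod>i<m - 1. if xs i \<noteq> 0 then 1 else ?t powr a)" .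
  have "(a * ?r / 2) ^ ?s * ?t \<le> (\<Prod>i<m - 1. if xs i \<noteq> 0 then a * ?r / 2 else 1) * (\<Prod>i<m - 1. if xs i \<noteq> 0 then 1 else ?t powr a)"
    by (rule mult_mono[OF p1 p2]) (use ar(1) less_imp_le[OF t(1)] in \<open>auto intro!: prod_nonneg\<close>)
  also have "\<dots> = (\<Prod>i<m - 1. a * h i)"
    unfolding prod.distrib[symmetric] using a by (intro prod.cong) (auto simp: h_def)
  also have "\<dots> = a ^ (m - 1) * (\<Prod>i<m - 1. h i)" by (simp add: prod.distrib)
  finally have "1 / (2 * real m) * ((a * ?r / 2) ^ ?s * ?t) \<le> 1 / (2 * real m) * (a ^ (m - 1) * (\<Prod>i<m - 1. h i))"
    using m by (intro mult_left_mono) auto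
  also have "\<dots> = a ^ (m - 1) / (2 * real m) * (\<Prod>i<m - 1. h i)" by simp
  also have "\<dots> \<le> ?c * (\<Prod>i<m - 1. h i)"
    using dirichlet_normalizer_ge[OF m a] h0 by (intro mult_right_mono prod_nonneg) auto
  finally have "1 / (2 * real m) * (a * ?r / 2) ^ ?s * ?t \<le> ?c * (\<Prod>i<m - 1. h i)" by (simp add: mult.assoc)
  then show ?thesis using main by (meson ennreal_leI order_trans)
qed

subsection \<open>Densities and Kullback-Leibler divergence\<close>

lemma PiM_density:
  assumes "finite I" and "product_sigma_finite M" and "product_sigma_finite (\<lambda>i. density (M i) (f i))"
    and f [measurable]: "\<And>i. i \<in> I \<Longrightarrow> f i \<in> borel_measurable (M i)"
  shows "Pi\<^sub>M I (\<lambda>i. density (M i) (f i)) = density (Pi\<^sub>M I M) (\<lambda>x. \<Prod>i\<in>I. f i (x i))"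
proof -
  interpret M: product_sigma_finite M by fact
  interpret N: product_sigma_finite "\<lambda>i. density (M i) (f i)" by fact
  have pm: "(\<lambda>x. \<Prod>i\<in>I. f i (x i)) \<in> borel_measurable (Pi\<^sub>M I M)"
    using assms(1) by measurable
  have "density (Pi\<^sub>M I M) (\<lambda>x. \<Prod>i\<in>I. f i (x i)) = Pi\<^sub>M I (\<lambda>i. density (M i) (f i))"
  proof (rule N.PiM_eqI)
    show "sets (density (Pi\<^sub>M I M) (\<lambda>x. \<Prod>i\<in>I. f i (x i))) = sets (Pi\<^sub>M I (\<lambda>i. density (M i) (f i)))"
      unfolding sets_density by (intro sets_PiM_cong) auto
    fix A assume A: "\<And>i. i \<in> I \<Longrightarrow> A i \<in> sets (density (M i) (f i))"
    then have A' [measurable]: "\<And>i. i \<in> I \<Longrightarrow> A i \<in> sets (M i)" by simp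
    have "emeasure (density (Pi\<^sub>M I M) (\<lambda>x. \<Prod>i\<in>I. f i (x i))) (Pi\<^sub>E I A)
       = (\<integral>\<^sup>+x. (\<Prod>i\<in>I. f i (x i)) * indicator (Pi\<^sub>E I A) x \<partial>Pi\<^sub>M I M)"
      using A' assms(1) pm by (intro emeasure_density sets_PiM_I_finite) auto
    also have "\<dots> = (\<integral>\<^sup>+x. (\<Prod>i\<in>I. f i (x i) * indicator (A i) (x i)) \<partial>Pi\<^sub>M I M)"
    proof (intro nn_integral_cong)
      fix x assume "x \<in> space (Pi\<^sub>M I M)"
      then have "indicator (Pi\<^sub>E I A) x = (\<Prod>i\<in>I. indicator (A i) (x i) :: ennreal)"
        using assms(1) by (auto simp: indicator_def space_PiM PiE_iff prod.neutral intro!: prod_zero[symmetric])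
      then show "(\<Prod>i\<in>I. f i (x i)) * indicator (Pi\<^sub>E I A) x = (\<Prod>i\<in>I. f i (x i) * indicator (A i) (x i))"
        by (simp add: prod.distrib)
    qed
    also have "\<dots> = (\<Prod>i\<in>I. \<integral>\<^sup>+y. f i y * indicator (A i) y \<partial>M i)"
      using assms(1) by (intro M.product_nn_integral_prod) auto
    also have "\<dots> = (\<Prod>i\<in>I. emeasure (density (M i) (f i)) (A i))"
      by (intro prod.cong) (auto simp: emeasure_density)
    finally show "emeasure (density (Pi\<^sub>M I M) (\<lambda>x. \<Prod>i\<in>I. f i (x i))) (Pi\<^sub>E I A)
       = (\<Prod>i\<in>I. emeasure (density (M i) (f i)) (A i))" .
  qed (use assms(1) in auto)
  then show ?thesis ..
qed

text \<open>\<open>product_sigma_finite\<close> speaks about all indices, whereas the factors of the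
  competitor are under control only on the index set. Off it they are replaced by a one-point space,
  which does not change the product.\<close>

lemma PiM_density_on:
  assumes I: "finite I" and sf: "\<And>i. i \<in> I \<Longrightarrow> sigma_finite_measure (M i)"
    "\<And>i. i \<in> I \<Longrightarrow> sigma_finite_measure (density (M i) (f i))"
    and f: "\<And>i. i \<in> I \<Longrightarrow> f i \<in> borel_measurable (M i)"
  shows "Pi\<^sub>M I (\<lambda>i. density (M i) (f i)) = density (Pi\<^sub>M I M) (\<lambda>x. \<Prod>i\<in>I. f i (x i))"
proof -
  define M' where "M' i = (if i \<in> I then M i else count_space {undefined})" for i
  define f' where "f' i = (if i \<in> I then f i else (\<lambda>_. 1))" for i
  have "Pi\<^sub>M I (\<lambda>i. density (M' i) (f' i)) = density (Pi\<^sub>M I M') (\<lambda>x. \<Prod>i\<in>I. f' i (x i))"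
  proof (rule PiM_density[OF I])
    show "product_sigma_finite M'"
      using sf(1) by (auto simp: product_sigma_finite_def M'_def intro: sigma_finite_measure_count_space_finite)
    show "product_sigma_finite (\<lambda>i. density (M' i) (f' i))"
      using sf(2) by (auto simp: product_sigma_finite_def M'_def f'_def density_1 intro: sigma_finite_measure_count_space_finite)
    show "f' i \<in> borel_measurable (M' i)" if "i \<in> I" for i using f[OF that] that by (simp add: M'_def f'_def)
  qed
  moreover have "Pi\<^sub>M I M' = Pi\<^sub>M I M" "Pi\<^sub>M I (\<lambda>i. density (M' i) (f' i)) = Pi\<^sub>M I (\<lambda>i. density (M i) (f i))"
    by (auto simp: M'_def f'_def intro!: PiM_cong)
  moreover have "(\<Prod>i\<in>I. f' i (x i)) = (\<Prod>i\<in>I. f i (x i))" for x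
    by (intro prod.cong) (auto simp: f'_def)
  ultimately show ?thesis by simp
qed

section \<open>Bounding the divergence from above and using it\<close>

lemma absolutely_continuous_density:
  "f \<in> borel_measurable p \<Longrightarrow> absolutely_continuous p (density p f)"
  unfolding absolutely_continuous_def
proof
  fix A assume "f \<in> borel_measurable p" and A: "A \<in> null_sets p"
  moreover have "AE x in p. x \<in> A \<longrightarrow> f x = 0" using AE_not_in[OF A] by eventually_elim simp
  ultimately show "A \<in> null_sets (density p f)" by (simp add: null_sets_density_iff null_setsD2)
qed

text \<open>The divergence is the mean of ln F under q. The lower bound L serves integrability:
  without it \<open>kl_div\<close> could be infinite. It leaves no trace in the conclusion and may
  therefore be very crude.\<close>

lemma kl_div_density_le:
  fixes F :: "'a \<Rightarrow> real"
  assumes "prob_space p" "prob_space q" and F [measurable]: "F \<in> borel_measurable p"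
    and q: "q = density p (\<lambda>x. ennreal (F x))"
    and AE: "AE x in q. L \<le> F x \<and> F x \<le> U" and L: "0 < L"
  shows "kl_div q p \<le> ereal (ln U)"
proof -
  interpret p: prob_space p by fact
  interpret q: prob_space q by fact
  have sq [measurable_cong, simp]: "sets q = sets p" by (simp add: q)
  have ac: "absolutely_continuous p q" unfolding q by (rule absolutely_continuous_density) simp
  have "AE x in p. ennreal (F x) = RN_deriv p q x"
    using q by (intro p.RN_deriv_unique) auto
  then have "AE x in q. ennreal (F x) = RN_deriv p q x"
    by (rule absolutely_continuous_AE[OF sq ac])
  then have e: "AE x in q. entropy_density (exp 1) p q x = ln (F x)"
    using AE
  proof eventually_elim
    case (elim x)
    then have "0 \<le> F x" using L by linarith
    with elim(1)[symmetric] show ?case by (simp add: entropy_density_def log_def)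
  qed
  have m: "entropy_density (exp 1) p q \<in> borel_measurable q"
    using measurable_entropy_density[of "exp 1" p q] by simp
  have b: "AE x in q. ln L \<le> ln (F x) \<and> ln (F x) \<le> ln U"
    using AE by eventually_elim (use L in auto)
  have i: "integrable q (\<lambda>x. ln (F x))"
  proof (rule q.integrable_const_bound)
    show "AE x in q. norm (ln (F x)) \<le> max \<bar>ln L\<bar> \<bar>ln U\<bar>"
      using b by eventually_elim auto
  qed simp
  have i2: "integrable q (entropy_density (exp 1) p q)"
    using i e m by (subst integrable_cong_AE[where g="\<lambda>x. ln (F x)"]) auto
  have "KL_divergence (exp 1) p q = (\<integral>x. ln (F x) \<partial>q)"
    unfolding KL_divergence_def using e m by (intro integral_cong_AE) auto
  also have "\<dots> \<le> (\<integral>x. ln U \<partial>q)"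
    using b i by (intro integral_mono_AE) auto
  also have "\<dots> = ln U" using q.prob_space by simp
  finally show ?thesis using ac i2 by (simp add: kl_div_def)
qed

text \<open>With f the density of q with respect to p, apply ln y \<le> y - 1 pointwise to y = exp g
  / (f M) and integrate under q. The mean of y is at most 1, so the mean of g - ln f is at most ln
  M.\<close>

lemma Donsker_Varadhan:
  fixes g :: "'a \<Rightarrow> real"
  assumes "prob_space p" "prob_space q" "sets q = sets p"
    and kl: "kl_div q p \<le> ereal B"
    and g [measurable]: "g \<in> borel_measurable p" and gi: "integrable q g"
    and M: "(\<integral>\<^sup>+x. ennreal (exp (g x)) \<partial>p) \<le> ennreal M" "0 < M"
  shows "integral\<^sup>L q g \<le> B + ln M"
proof -
  interpret p: prob_space p by fact
  interpret q: prob_space q by fact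
  note assms(3) [measurable_cong, simp]
  have ac: "absolutely_continuous p q" and i: "integrable q (entropy_density (exp 1) p q)"
    and KL: "KL_divergence (exp 1) p q \<le> B"
    using kl by (auto simp: kl_div_def split: if_splits)
  define f where "f x = enn2real (RN_deriv p q x)" for x
  have [measurable]: "f \<in> borel_measurable p" by (simp add: f_def[abs_def])
  have ent: "entropy_density (exp 1) p q = (\<lambda>x. ln (f x))"
    by (simp add: entropy_density_def f_def[abs_def] fun_eq_iff log_def)
  have d0: "density p (RN_deriv p q) = q" by (rule p.density_RN_deriv[OF ac]) simp
  have "AE x in p. RN_deriv p q x \<noteq> \<infinity>"
    using ac q.sigma_finite_measure_axioms by (intro p.RN_deriv_finite) auto
  then have "AE x in p. ennreal (f x) = RN_deriv p q x"
    by eventually_elim (simp add: f_def less_top)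
  then have "density p (\<lambda>x. ennreal (f x)) = density p (RN_deriv p q)"
    by (intro density_cong) auto
  with d0 have d: "q = density p (\<lambda>x. ennreal (f x))" by simp
  have fpos: "AE x in q. 0 < f x"
    by (subst d, subst AE_density) (auto simp: f_def)
  have "(\<integral>\<^sup>+x. ennreal (exp (g x) / f x) \<partial>q) = (\<integral>\<^sup>+x. ennreal (f x) * ennreal (exp (g x) / f x) \<partial>p)"
    by (subst d, subst nn_integral_density) auto
  \<comment> \<open>Where f vanishes, the integrand on the left is 0 by the convention for division
    by zero, so only an inequality holds.\<close>
  also have "\<dots> \<le> (\<integral>\<^sup>+x. ennreal (exp (g x)) \<partial>p)"
    by (intro nn_integral_mono) (auto simp: ennreal_mult''[symmetric] f_def)
  also note M(1)
  finally have I: "(\<integral>\<^sup>+x. ennreal (exp (g x) / f x) \<partial>q) \<le> ennreal M" .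
  have f0: "0 \<le> f x" for x by (simp add: f_def)
  have ii: "integrable q (\<lambda>x. exp (g x) / f x)"
    using I f0 by (intro integrableI_bounded) (auto simp: order_le_less_trans)
  have "ennreal (\<integral>x. exp (g x) / f x \<partial>q) \<le> ennreal M"
    using I f0 by (subst nn_integral_eq_integral[symmetric]) (auto simp: ii)
  then have IM: "(\<integral>x. exp (g x) / f x \<partial>q) \<le> M" using M(2) by simp
  have pt: "AE x in q. g x - ln (f x) \<le> exp (g x) / f x / M - 1 + ln M"
    using fpos
  proof eventually_elim
    case (elim x)
    have "ln (exp (g x) / f x / M) \<le> exp (g x) / f x / M - 1"
      using elim M(2) by (intro ln_le_minus_one) auto
    also have "ln (exp (g x) / f x / M) = g x - ln (f x) - ln M"
      using elim M(2) by (simp add: ln_div ln_mult)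
    finally show ?case by simp
  qed
  have "integral\<^sup>L q g - (\<integral>x. ln (f x) \<partial>q) = (\<integral>x. g x - ln (f x) \<partial>q)"
    using gi i by (simp add: ent)
  also have "\<dots> \<le> (\<integral>x. exp (g x) / f x / M - 1 + ln M \<partial>q)"
    using pt gi i ii
    by (intro integral_mono_AE Bochner_Integration.integrable_add Bochner_Integration.integrable_diff
        integrable_divide integrable_const) (auto simp: ent)
  also have "\<dots> = (\<integral>x. exp (g x) / f x \<partial>q) / M - 1 + ln M"
  proof -
    have "(\<integral>x. h x / M - 1 + ln M \<partial>q) = (\<integral>x. h x \<partial>q) / M - 1 + ln M" if "integrable q h" for h
      using that q.prob_space by simp
    from this[OF ii] show ?thesis .
  qed
  also have "\<dots> \<le> ln M" using IM M(2) by (simp add: field_simps)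
  finally show ?thesis using KL by (simp add: KL_divergence_def ent)
qed

subsection \<open>Words and counts\<close>

text \<open>Put g = sqrt(p / q) - 1, so that p / q \<le> exp(2 g). Grouping positions by word, the
  exponent is 2 N \<Sum> q g plus a fluctuation linear in the counts. The first part is the drift -
  N h^2, with h^2 the squared Hellinger distance; the fluctuation is at most twice the chi-square
  statistic plus N / 2 times h^2. Half of the drift survives.\<close>

lemma likelihood_ratio_bound:
  fixes p q :: "nat \<Rightarrow> real" and ws :: "nat \<Rightarrow> nat"
  assumes p: "\<And>v. v < V \<Longrightarrow> 0 \<le> p v" "(\<Sum>v<V. p v) = 1"
    and q: "\<And>v. v < V \<Longrightarrow> 0 \<le> q v" "(\<Sum>v<V. q v) = 1"
    and ws: "\<And>n. n < N \<Longrightarrow> ws n < V \<and> 0 < q (ws n)"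
  defines "c \<equiv> \<lambda>v. real (card {n. n < N \<and> ws n = v})"
  assumes N: "0 < N"
  shows "(\<Prod>n<N. p (ws n)) * exp (real N / 2 * (\<Sum>v<V. (sqrt (p v) - sqrt (q v))\<^sup>2))
    \<le> (\<Prod>n<N. q (ws n)) * exp (2 * (\<Sum>v | v < V \<and> 0 < q v. (c v - real N * q v)\<^sup>2 / (real N * q v)))"
proof -
  let ?S = "{v. v < V \<and> 0 < q v}"
  let ?h = "\<Sum>v<V. (sqrt (p v) - sqrt (q v))\<^sup>2"
  let ?X = "\<Sum>v\<in>?S. (c v - real N * q v)\<^sup>2 / (real N * q v)"
  define g where "g v = sqrt (p v / q v) - 1" for v
  have fin: "finite ?S" by simp
  have qg: "q v * g v = sqrt (p v * q v) - q v" if "v \<in> ?S" for v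
    using that by (simp add: g_def real_sqrt_divide real_sqrt_mult field_simps)
  have qg2: "q v * (g v)\<^sup>2 = (sqrt (p v) - sqrt (q v))\<^sup>2" if "v \<in> ?S" for v
  proof -
    have "g v = (sqrt (p v) - sqrt (q v)) / sqrt (q v)" using that by (simp add: g_def real_sqrt_divide diff_divide_distrib)
    then have "(g v)\<^sup>2 = (sqrt (p v) - sqrt (q v))\<^sup>2 / q v" using that by (simp add: power_divide)
    then show ?thesis using that by simp
  qed
  have "?h = (\<Sum>v<V. p v + q v - 2 * sqrt (p v * q v))"
    by (intro sum.cong) (auto simp: power2_diff real_sqrt_mult p q)
  also have "\<dots> = 2 - 2 * (\<Sum>v<V. sqrt (p v * q v))"
    by (simp add: sum_subtractf sum.distrib p q sum_distrib_left[symmetric])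
  also have "(\<Sum>v<V. sqrt (p v * q v)) = (\<Sum>v\<in>?S. sqrt (p v * q v))"
    using q(1) by (intro sum.mono_neutral_right) (auto simp: less_le)
  finally have h: "(\<Sum>v\<in>?S. sqrt (p v * q v)) = 1 - ?h / 2" by linarith
  have q1: "(\<Sum>v\<in>?S. q v) = 1"
    using q by (subst q(2)[symmetric], intro sum.mono_neutral_left) (auto simp: less_le)
  have A: "(\<Sum>v\<in>?S. q v * g v) = - ?h / 2"
    using h q1 qg by (simp add: sum_subtractf)
  have "(\<Sum>n<N. g (ws n)) = (\<Sum>v\<in>?S. \<Sum>n\<in>{n\<in>{..<N}. ws n = v}. g (ws n))"
    using ws by (intro sum.group[symmetric]) auto
  also have "\<dots> = (\<Sum>v\<in>?S. c v * g v)"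
    by (intro sum.cong refl) (simp add: c_def)
  finally have G: "(\<Sum>n<N. g (ws n)) = (\<Sum>v\<in>?S. c v * g v)" .
  have G2: "2 * (\<Sum>v\<in>?S. c v * g v) = 2 * real N * (\<Sum>v\<in>?S. q v * g v) + (\<Sum>v\<in>?S. 2 * (c v - real N * q v) * g v)"
    by (simp add: sum_distrib_left sum.distrib[symmetric] algebra_simps)
  have "(\<Sum>v\<in>?S. 2 * (c v - real N * q v) * g v)
     \<le> (\<Sum>v\<in>?S. 2 * ((c v - real N * q v)\<^sup>2 / (real N * q v)) + real N / 2 * (q v * (g v)\<^sup>2))"
  proof (intro sum_mono)
    fix v assume v: "v \<in> ?S"
    define m where "m = real N * q v"
    have m: "0 < m" using v N by (simp add: m_def)
    \<comment> \<open>Young's inequality; the weights are chosen so that the term quadratic in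
      \<open>g v\<close> consumes only half of the drift.\<close>
    have "2 * (c v - m) * g v \<le> 2 * ((c v - m)\<^sup>2 / m) + m / 2 * (g v)\<^sup>2"
    proof -
      have "0 \<le> (2 * (c v - m) - m * g v)\<^sup>2 / (2 * m)" using m by simp
      also have "\<dots> = 2 * ((c v - m)\<^sup>2 / m) + m / 2 * (g v)\<^sup>2 - 2 * (c v - m) * g v"
        using m by (simp add: power2_eq_square field_simps)
      finally show ?thesis by simp
    qed
    then show "2 * (c v - real N * q v) * g v \<le> 2 * ((c v - real N * q v)\<^sup>2 / (real N * q v)) + real N / 2 * (q v * (g v)\<^sup>2)"
      by (simp add: m_def)
  qed
  also have "\<dots> = 2 * ?X + real N / 2 * (\<Sum>v\<in>?S. q v * (g v)\<^sup>2)"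
    by (simp only: sum.distrib sum_distrib_left)
  finally have G3: "(\<Sum>v\<in>?S. 2 * (c v - real N * q v) * g v) \<le> 2 * ?X + real N / 2 * (\<Sum>v\<in>?S. q v * (g v)\<^sup>2)" .
  have "(\<Sum>v\<in>?S. q v * (g v)\<^sup>2) = (\<Sum>v\<in>?S. (sqrt (p v) - sqrt (q v))\<^sup>2)"
    by (intro sum.cong refl qg2)
  \<comment> \<open>Words outside the support of q contribute to the Hellinger distance
    only.\<close>
  moreover have "(\<Sum>v\<in>?S. (sqrt (p v) - sqrt (q v))\<^sup>2) \<le> ?h"
    by (intro sum_mono2) auto
  ultimately have "real N / 2 * (\<Sum>v\<in>?S. q v * (g v)\<^sup>2) \<le> real N / 2 * ?h"
    by (intro mult_left_mono) auto
  \<comment> \<open>The drift, split into the half that absorbs the quadratic term and the half that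
    remains in the claim.\<close>
  moreover have "2 * real N * (\<Sum>v\<in>?S. q v * g v) = - (real N / 2 * ?h) - real N / 2 * ?h"
    unfolding A by simp
  ultimately have E: "2 * (\<Sum>n<N. g (ws n)) + real N / 2 * ?h \<le> 2 * ?X"
    using G G2 G3 by linarith
  have "(\<Prod>n<N. p (ws n)) \<le> (\<Prod>n<N. q (ws n) * exp (2 * g (ws n)))"
  proof (intro prod_mono conjI)
    fix n assume n: "n \<in> {..<N}"
    then have v: "ws n < V" "0 < q (ws n)" using ws by auto
    show "0 \<le> p (ws n)" using p(1) v by simp
    have "sqrt (p (ws n) / q (ws n)) \<le> exp (g (ws n))"
      using exp_ge_add_one_self[of "g (ws n)"] by (simp add: g_def)
    then have "(sqrt (p (ws n) / q (ws n)))\<^sup>2 \<le> (exp (g (ws n)))\<^sup>2"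
      using v p(1) by (intro power_mono) auto
    then have "p (ws n) / q (ws n) \<le> exp (2 * g (ws n))"
      using v p(1) by (simp add: exp_double)
    then show "p (ws n) \<le> q (ws n) * exp (2 * g (ws n))" using v by (simp add: field_simps)
  qed
  also have "\<dots> = (\<Prod>n<N. q (ws n)) * exp (2 * (\<Sum>n<N. g (ws n)))"
    by (simp add: prod.distrib exp_sum sum_distrib_left)
  finally have "(\<Prod>n<N. p (ws n)) * exp (real N / 2 * ?h)
      \<le> (\<Prod>n<N. q (ws n)) * exp (2 * (\<Sum>n<N. g (ws n))) * exp (real N / 2 * ?h)"
    by (intro mult_right_mono) auto
  also have "\<dots> = (\<Prod>n<N. q (ws n)) * exp (2 * (\<Sum>n<N. g (ws n)) + real N / 2 * ?h)"
    by (simp add: exp_add)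
  also have "\<dots> \<le> (\<Prod>n<N. q (ws n)) * exp (2 * ?X)"
    using E ws by (intro mult_left_mono prod_nonneg) (auto simp: less_imp_le)
  finally show ?thesis .
qed

section \<open>The law of a word and moments of word counts\<close>

lemma pmf_cat_pmf:
  assumes "p \<in> prob_simplex m"
  shows "pmf (cat_pmf m p) i = (if i < m then p i else 0)"
  unfolding cat_pmf_def
proof (rule pmf_embed_pmf)
  show "0 \<le> (if x < m then p x else 0)" for x using assms by (simp add: prob_simplex_def)
  have "(\<integral>\<^sup>+x. ennreal (if x < m then p x else 0) \<partial>count_space UNIV) = (\<Sum>x<m. ennreal (p x))"
    by (subst nn_integral_count_space'[of "{..<m}"]) auto
  also have "\<dots> = 1" using assms by (subst sum_ennreal) (auto simp: prob_simplex_def)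
  finally show "(\<integral>\<^sup>+x. ennreal (if x < m then p x else 0) \<partial>count_space UNIV) = 1" .
qed

lemma word_prob_nonneg:
  assumes "fst \<theta> d \<in> prob_simplex K" "\<And>k. k < K \<Longrightarrow> snd \<theta> k \<in> prob_simplex V" "v < V"
  shows "0 \<le> word_prob K \<theta> d v"
  using assms unfolding word_prob_def by (intro sum_nonneg mult_nonneg_nonneg) (auto simp: prob_simplex_def)

lemma sum_word_prob:
  assumes "fst \<theta> d \<in> prob_simplex K" "\<And>k. k < K \<Longrightarrow> snd \<theta> k \<in> prob_simplex V"
  shows "(\<Sum>v<V. word_prob K \<theta> d v) = 1"
proof -
  have "(\<Sum>v<V. word_prob K \<theta> d v) = (\<Sum>k<K. fst \<theta> d k * (\<Sum>v<V. snd \<theta> k v))"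
    unfolding word_prob_def by (subst sum.swap) (simp add: sum_distrib_left)
  also have "\<dots> = 1" using assms by (simp add: prob_simplex_def)
  finally show ?thesis .
qed

lemma pmf_word:
  assumes "fst \<theta> d \<in> prob_simplex K" "\<And>k. k < K \<Longrightarrow> snd \<theta> k \<in> prob_simplex V"
  shows "pmf (bind_pmf (cat_pmf K (fst \<theta> d)) (\<lambda>k. cat_pmf V (snd \<theta> k))) v = (if v < V then word_prob K \<theta> d v else 0)"
proof -
  have "pmf (bind_pmf (cat_pmf K (fst \<theta> d)) (\<lambda>k. cat_pmf V (snd \<theta> k))) v
     = (\<Sum>k<K. pmf (cat_pmf K (fst \<theta> d)) k *\<^sub>R pmf (cat_pmf V (snd \<theta> k)) v)"
    unfolding pmf_bind
    by (intro integral_measure_pmf) (auto simp: set_pmf_iff pmf_cat_pmf[OF assms(1)] split: if_splits)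
  then show ?thesis using assms by (simp add: pmf_cat_pmf word_prob_def)
qed

lemma expectation_prod_Pi_pmf_subset:
  fixes f :: "'a \<Rightarrow> 'b \<Rightarrow> real"
  assumes "finite A" "S \<subseteq> A" "\<And>x. x \<in> A \<Longrightarrow> finite (set_pmf (p x))" "\<And>x y. 0 \<le> f x y"
  shows "measure_pmf.expectation (Pi_pmf A dflt p) (\<lambda>w. \<Prod>x\<in>S. f x (w x))
    = (\<Prod>x\<in>S. measure_pmf.expectation (p x) (f x))"
proof -
  \<comment> \<open>Factors outside \<open>S\<close> are padded with 1, which reduces the claim to a
    product over the whole index set.\<close>
  have 1: "(\<Prod>x\<in>S. f x (w x)) = (\<Prod>x\<in>A. if x \<in> S then f x (w x) else 1)" for w
    using assms(1,2) by (subst prod.inter_restrict[symmetric]) (auto simp: Int_absorb1)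
  have "measure_pmf.expectation (Pi_pmf A dflt p) (\<lambda>w. \<Prod>x\<in>A. (\<lambda>x y. if x \<in> S then f x y else 1) x (w x))
      = (\<Prod>x\<in>A. measure_pmf.expectation (p x) (\<lambda>y. if x \<in> S then f x y else 1))"
    using assms by (intro expectation_prod_Pi_pmf) (auto intro: integrable_measure_pmf_finite)
  also have "\<dots> = (\<Prod>x\<in>A. if x \<in> S then measure_pmf.expectation (p x) (f x) else 1)"
    by (intro prod.cong) auto
  also have "\<dots> = (\<Prod>x\<in>S. measure_pmf.expectation (p x) (f x))"
    using assms(1,2) by (subst prod.inter_restrict[symmetric]) (auto simp: Int_absorb1)
  finally show ?thesis by (simp add: 1)
qed

lemma finite_set_Pi_pmf:
  assumes "finite A" "\<And>x. x \<in> A \<Longrightarrow> finite (set_pmf (p x))"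
  shows "finite (set_pmf (Pi_pmf A dflt p))"
  using assms by (auto simp: set_Pi_pmf)

text \<open>The binomial variance, from the first moments of the indicators and of their pairwise
  products. Only the positions in B share the law P: B will be one document, A the positions of all
  of them.\<close>

lemma expectation_count_deviation:
  fixes p :: "'a \<Rightarrow> 'b pmf"
  assumes A: "finite A" "\<And>x. x \<in> A \<Longrightarrow> finite (set_pmf (p x))"
    and B: "B \<subseteq> A" "\<And>x. x \<in> B \<Longrightarrow> p x = P"
  shows "measure_pmf.expectation (Pi_pmf A dflt p)
      (\<lambda>w. (real (card {x\<in>B. w x = v}) - real (card B) * pmf P v)\<^sup>2) = real (card B) * pmf P v * (1 - pmf P v)"
proof -
  let ?E = "measure_pmf.expectation (Pi_pmf A dflt p)"
  define I :: "'a \<Rightarrow> ('a \<Rightarrow> 'b) \<Rightarrow> real" where "I x w = indicator {v} (w x)" for x w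
  let ?\<pi> = "pmf P v"
  have fB: "finite B" using A(1) B(1) by (rule rev_finite_subset)
  have int: "integrable (Pi_pmf A dflt p) f" for f :: "_ \<Rightarrow> real"
    using finite_set_Pi_pmf[OF A] by (rule integrable_measure_pmf_finite)
  have ind: "measure_pmf.expectation P (indicator {v}) = ?\<pi>"
    by (simp add: measure_pmf_single)
  have prod: "?E (\<lambda>w. \<Prod>x\<in>S. I x w) = ?\<pi> ^ card S" if "S \<subseteq> B" for S
  proof -
    have "?E (\<lambda>w. \<Prod>x\<in>S. I x w) = (\<Prod>x\<in>S. measure_pmf.expectation (p x) (indicator {v}))"
      unfolding I_def using A that B by (intro expectation_prod_Pi_pmf_subset) auto
    also have "\<dots> = (\<Prod>x\<in>S. ?\<pi>)" using that B(2) ind by (intro prod.cong) auto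
    finally show ?thesis by simp
  qed
  have E1: "?E (I x) = ?\<pi>" if "x \<in> B" for x
    using prod[of "{x}"] that by simp
  have E2: "?E (\<lambda>w. I x w * I y w) = (if x = y then ?\<pi> else ?\<pi>\<^sup>2)" if "x \<in> B" "y \<in> B" for x y
  proof (cases "x = y")
    case True
    have "(\<lambda>w. I x w * I y w) = I x" by (auto simp: True I_def indicator_def)
    with E1[OF that(1)] True show ?thesis by simp
  next
    case False
    then show ?thesis using prod[of "{x, y}"] that by (simp add: power2_eq_square)
  qed
  have c: "real (card {x\<in>B. w x = v}) = (\<Sum>x\<in>B. I x w)" for w
  proof -
    have "(\<Sum>x\<in>B. I x w) = (\<Sum>x\<in>{x\<in>B. w x = v}. 1)"
      using fB by (intro sum.mono_neutral_cong_right) (auto simp: I_def)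
    then show ?thesis by simp
  qed
  let ?M = "real (card B)"
  have "?E (\<lambda>w. (real (card {x\<in>B. w x = v}) - ?M * ?\<pi>)\<^sup>2)
     = ?E (\<lambda>w. (\<Sum>x\<in>B. \<Sum>y\<in>B. I x w * I y w) - 2 * ?M * ?\<pi> * (\<Sum>x\<in>B. I x w) + (?M * ?\<pi>)\<^sup>2)"
    unfolding c by (intro Bochner_Integration.integral_cong) (simp_all add: sum_product[symmetric] power2_eq_square algebra_simps)
  also have "\<dots> = (\<Sum>x\<in>B. \<Sum>y\<in>B. ?E (\<lambda>w. I x w * I y w)) - 2 * ?M * ?\<pi> * (\<Sum>x\<in>B. ?E (I x)) + (?M * ?\<pi>)\<^sup>2"
    using int by simp
  also have "(\<Sum>x\<in>B. ?E (I x)) = ?M * ?\<pi>" using E1 by simp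
  also have "(\<Sum>x\<in>B. \<Sum>y\<in>B. ?E (\<lambda>w. I x w * I y w)) = (\<Sum>x\<in>B. ?\<pi> + (?M - 1) * ?\<pi>\<^sup>2)"
  proof (intro sum.cong refl)
    fix x assume x: "x \<in> B"
    have "(\<Sum>y\<in>B. ?E (\<lambda>w. I x w * I y w)) = (\<Sum>y\<in>B. if x = y then ?\<pi> else ?\<pi>\<^sup>2)"
      using E2[OF x] by (intro sum.cong) auto
    also have "\<dots> = (if x = x then ?\<pi> else ?\<pi>\<^sup>2) + (\<Sum>y\<in>B - {x}. if x = y then ?\<pi> else ?\<pi>\<^sup>2)"
      by (rule sum.remove[OF fB x])
    also have "(\<Sum>y\<in>B - {x}. if x = y then ?\<pi> else ?\<pi>\<^sup>2) = (\<Sum>y\<in>B - {x}. ?\<pi>\<^sup>2)"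
      by (intro sum.cong) auto
    also have "\<dots> = (?M - 1) * ?\<pi>\<^sup>2"
    proof -
      have "1 \<le> card B" using x fB by (metis One_nat_def Suc_leI card_gt_0_iff empty_iff)
      then show ?thesis using x fB by (simp add: card_Diff_singleton of_nat_diff)
    qed
    finally show "(\<Sum>y\<in>B. ?E (\<lambda>w. I x w * I y w)) = ?\<pi> + (?M - 1) * ?\<pi>\<^sup>2" by simp
  qed
  also have "(\<Sum>x\<in>B. ?\<pi> + (?M - 1) * ?\<pi>\<^sup>2) - 2 * ?M * ?\<pi> * (?M * ?\<pi>) + (?M * ?\<pi>)\<^sup>2 = ?M * ?\<pi> * (1 - ?\<pi>)"
    by (simp add: power2_eq_square algebra_simps)
  finally show ?thesis .
qed

subsection \<open>The model\<close>

lemma prob_space_density_indicator: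
  assumes "prob_space M" "A \<in> sets M" "0 < measure M A"
  shows "prob_space (density M (\<lambda>x. ennreal (indicator A x / measure M A)))"
proof
  interpret prob_space M by fact
  have "(\<integral>\<^sup>+x. ennreal (indicator A x / measure M A) \<partial>M) = (\<integral>\<^sup>+x. ennreal (1 / measure M A) * indicator A x \<partial>M)"
    by (intro nn_integral_cong) (auto simp: indicator_def)
  also have "\<dots> = ennreal (1 / measure M A) * emeasure M A" using assms(2) by (rule nn_integral_cmult_indicator)
  also have "\<dots> = 1" using assms(3) by (simp add: emeasure_eq_measure ennreal_mult'[symmetric])
  finally have "(\<integral>\<^sup>+x. ennreal (indicator A x / measure M A) \<partial>M) = 1" .
  moreover have "(\<lambda>x. ennreal (indicator A x / measure M A)) \<in> borel_measurable M"
    using assms(2) by (intro measurable_compose[OF _ measurable_ennreal] borel_measurable_divide borel_measurable_indicator borel_measurable_const)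
  ultimately show "emeasure (density M (\<lambda>x. ennreal (indicator A x / measure M A)))
      (space (density M (\<lambda>x. ennreal (indicator A x / measure M A)))) = 1"
    by (simp add: emeasure_density cong: nn_integral_cong)
qed

lemma sets_lda_prior: "sets (lda_prior c K V D) = sets (lda_param_space K V D)"
  unfolding lda_prior_def lda_param_space_def by (intro sets_pair_measure_cong sets_PiM_cong) auto

lemma space_lda_param_space:
  "space (lda_param_space K V D) = (\<Pi>\<^sub>E d\<in>{..<D}. prob_simplex K) \<times> (\<Pi>\<^sub>E k\<in>{..<K}. prob_simplex V)"
  by (simp add: lda_param_space_def space_pair_measure space_PiM space_simplex_space)

lemma space_lda_prior: "space (lda_prior c K V D) = space (lda_param_space K V D)"
  using sets_lda_prior by (rule sets_eq_imp_space_eq)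

lemma sets_lda_base:
  "sets (lda_base c K V D N) = sets (lda_param_space K V D \<Otimes>\<^sub>M Pi\<^sub>M ({..<D} \<times> {..<N}) (\<lambda>_. count_space {..<K}))"
  unfolding lda_base_def by (intro sets_pair_measure_cong sets_lda_prior refl)

lemma space_lda_base:
  "space (lda_base c K V D N) = space (lda_param_space K V D) \<times> (\<Pi>\<^sub>E p\<in>{..<D} \<times> {..<N}. {..<K})"
  by (simp add: lda_base_def space_pair_measure space_lda_prior space_PiM)

lemma prob_space_lda_prior:
  assumes "0 < K" "0 < V"
  shows "prob_space (lda_prior c K V D)"
proof -
  interpret P1: prob_space "Pi\<^sub>M {..<D} (\<lambda>_. dirichlet K (1 / real K powr c))"
    using assms by (intro prob_space_PiM prob_space_dirichlet) auto
  interpret P2: prob_space "Pi\<^sub>M {..<K} (\<lambda>_. dirichlet V (1 / real V powr c))"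
    using assms by (intro prob_space_PiM prob_space_dirichlet) auto
  interpret pair_prob_space "Pi\<^sub>M {..<D} (\<lambda>_. dirichlet K (1 / real K powr c))" "Pi\<^sub>M {..<K} (\<lambda>_. dirichlet V (1 / real V powr c))" ..
  show ?thesis unfolding lda_prior_def by (rule prob_space_axioms)
qed

section \<open>The complete likelihood: measurability and summation over the assignments\<close>

lemma topic_component_measurable:
  assumes "d < D"
  shows "(\<lambda>\<theta>. fst \<theta> d k) \<in> borel_measurable (lda_param_space K V D)"
proof -
  have "(\<lambda>\<theta>. fst \<theta> d) \<in> measurable (lda_param_space K V D) (simplex_space K)"
    unfolding lda_param_space_def
    by (rule measurable_compose[OF measurable_fst measurable_component_singleton]) (use assms in simp)
  from measurable_compose[OF this simplex_space_component] show ?thesis .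
qed

lemma vocab_component_measurable:
  assumes "k < K"
  shows "(\<lambda>\<theta>. snd \<theta> k v) \<in> borel_measurable (lda_param_space K V D)"
proof -
  have "(\<lambda>\<theta>. snd \<theta> k) \<in> measurable (lda_param_space K V D) (simplex_space V)"
    unfolding lda_param_space_def
    by (rule measurable_compose[OF measurable_snd measurable_component_singleton]) (use assms in simp)
  from measurable_compose[OF this simplex_space_component] show ?thesis .
qed

lemma word_prob_measurable:
  assumes "d < D"
  shows "(\<lambda>\<theta>. word_prob K \<theta> d v) \<in> borel_measurable (lda_param_space K V D)"
  unfolding word_prob_def
  by (intro borel_measurable_sum borel_measurable_times topic_component_measurable vocab_component_measurable assms) simp

lemma lda_complete_lik_alt:
  "lda_complete_lik D N w x = (\<Prod>p\<in>{..<D} \<times> {..<N}. fst (fst x) (fst p) (snd x p) * snd (fst x) (snd x p) (w p))"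
  by (cases x) (auto simp: lda_complete_lik_def intro!: prod.cong)

lemma lda_complete_lik_measurable:
  "lda_complete_lik D N w \<in> borel_measurable (lda_base c K V D N)"
proof -
  let ?M = "lda_param_space K V D \<Otimes>\<^sub>M Pi\<^sub>M ({..<D} \<times> {..<N}) (\<lambda>_. count_space {..<K})"
  have "(\<lambda>x. \<Prod>p\<in>{..<D} \<times> {..<N}. fst (fst x) (fst p) (snd x p) * snd (fst x) (snd x p) (w p)) \<in> borel_measurable ?M"
  proof (intro borel_measurable_prod)
    fix p assume p: "p \<in> {..<D} \<times> {..<N}"
    have z: "(\<lambda>x. snd x p) \<in> measurable ?M (count_space {..<K})"
      by (rule measurable_compose[OF measurable_snd measurable_component_singleton[OF p]])
    show "(\<lambda>x. fst (fst x) (fst p) (snd x p) * snd (fst x) (snd x p) (w p)) \<in> borel_measurable ?M"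
    \<comment> \<open>Which component is read depends on the assignment itself; as there are
      finitely many topics, it is enough to treat each fixed topic.\<close>
    proof (rule measurable_compose_countable'[OF _ z, where f="\<lambda>k x. fst (fst x) (fst p) k * snd (fst x) k (w p)"])
      fix k assume "k \<in> {..<K}"
      then show "(\<lambda>x. fst (fst x) (fst p) k * snd (fst x) k (w p)) \<in> borel_measurable ?M"
        using p
        by (intro borel_measurable_times measurable_compose[OF measurable_fst topic_component_measurable]
            measurable_compose[OF measurable_fst vocab_component_measurable]) auto
    qed simp
  qed
  then show ?thesis
    by (subst measurable_cong_sets[OF sets_lda_base refl]) (simp add: lda_complete_lik_alt[abs_def])
qed

lemma lda_complete_lik_bounds:
  assumes "x \<in> space (lda_base c K V D N)" "\<And>p. p \<in> {..<D} \<times> {..<N} \<Longrightarrow> w p < V"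
  shows "0 \<le> lda_complete_lik D N w x" "lda_complete_lik D N w x \<le> 1"
proof -
  have *: "0 \<le> fst (fst x) (fst p) (snd x p)" "fst (fst x) (fst p) (snd x p) \<le> 1"
    "0 \<le> snd (fst x) (snd x p) (w p)" "snd (fst x) (snd x p) (w p) \<le> 1" if p: "p \<in> {..<D} \<times> {..<N}" for p
  proof -
    have "snd x p < K" "fst (fst x) (fst p) \<in> prob_simplex K"
      using assms(1) p by (cases p, auto simp: space_lda_base space_lda_param_space PiE_iff)+
    moreover from this have "snd (fst x) (snd x p) \<in> prob_simplex V"
      using assms(1) by (auto simp: space_lda_base space_lda_param_space PiE_iff)
    ultimately show "0 \<le> fst (fst x) (fst p) (snd x p)" "fst (fst x) (fst p) (snd x p) \<le> 1"
      "0 \<le> snd (fst x) (snd x p) (w p)" "snd (fst x) (snd x p) (w p) \<le> 1"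
      using assms(2)[OF p] prob_simplex_le_1 by (auto simp: prob_simplex_def)
  qed
  show "0 \<le> lda_complete_lik D N w x" unfolding lda_complete_lik_alt
    by (intro prod_nonneg mult_nonneg_nonneg *)
  show "lda_complete_lik D N w x \<le> 1" unfolding lda_complete_lik_alt
    by (intro prod_le_1 conjI mult_nonneg_nonneg mult_le_one *)
qed

text \<open>Integrating a product over positions against a product of counting measures gives the
  product of the sums over topics. This leads from the complete likelihood to the word likelihood,
  the one that \<open>likelihood_ratio_bound\<close> controls.\<close>

lemma nn_integral_assignments:
  assumes "\<theta> \<in> space (lda_param_space K V D)" "\<And>p. p \<in> {..<D} \<times> {..<N} \<Longrightarrow> w p < V"
  shows "(\<integral>\<^sup>+z. ennreal (lda_complete_lik D N w (\<theta>, z)) \<partial>Pi\<^sub>M ({..<D} \<times> {..<N}) (\<lambda>_. count_space {..<K}))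
    = ennreal (\<Prod>d<D. \<Prod>n<N. word_prob K \<theta> d (w (d, n)))"
proof -
  interpret product_sigma_finite "\<lambda>_ :: nat \<times> nat. count_space {..<K}"
    by (simp add: product_sigma_finite_def sigma_finite_measure_count_space_finite)
  let ?I = "{..<D} \<times> {..<N}"
  have nn: "0 \<le> fst \<theta> (fst p) k * snd \<theta> k (w p)" if "p \<in> ?I" "k < K" for p k
    using assms(1) assms(2)[OF that(1)] that
    by (auto simp: space_lda_param_space PiE_iff prob_simplex_def mem_Times_iff)
  have "(\<integral>\<^sup>+z. ennreal (lda_complete_lik D N w (\<theta>, z)) \<partial>Pi\<^sub>M ?I (\<lambda>_. count_space {..<K}))
     = (\<integral>\<^sup>+z. (\<Prod>p\<in>?I. ennreal (fst \<theta> (fst p) (z p) * snd \<theta> (z p) (w p))) \<partial>Pi\<^sub>M ?I (\<lambda>_. count_space {..<K}))"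
  proof (intro nn_integral_cong)
    fix z assume "z \<in> space (Pi\<^sub>M ?I (\<lambda>_. count_space {..<K}))"
    then have "\<And>p. p \<in> ?I \<Longrightarrow> z p < K" by (auto simp: space_PiM PiE_iff)
    then show "ennreal (lda_complete_lik D N w (\<theta>, z)) = (\<Prod>p\<in>?I. ennreal (fst \<theta> (fst p) (z p) * snd \<theta> (z p) (w p)))"
      unfolding lda_complete_lik_alt using nn by (subst prod_ennreal) auto
  qed
  also have "\<dots> = (\<Prod>p\<in>?I. \<integral>\<^sup>+k. ennreal (fst \<theta> (fst p) k * snd \<theta> k (w p)) \<partial>count_space {..<K})"
    by (rule product_nn_integral_prod) auto
  also have "\<dots> = (\<Prod>p\<in>?I. ennreal (word_prob K \<theta> (fst p) (w p)))"
  proof (intro prod.cong refl)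
    fix p assume "p \<in> ?I"
    then show "(\<integral>\<^sup>+k. ennreal (fst \<theta> (fst p) k * snd \<theta> k (w p)) \<partial>count_space {..<K}) = ennreal (word_prob K \<theta> (fst p) (w p))"
      using nn unfolding word_prob_def by (subst nn_integral_count_space_finite) (auto intro!: sum_ennreal)
  qed
  also have "\<dots> = ennreal (\<Prod>p\<in>?I. word_prob K \<theta> (fst p) (w p))"
    unfolding word_prob_def using nn by (intro prod_ennreal sum_nonneg) auto
  also have "(\<Prod>p\<in>?I. word_prob K \<theta> (fst p) (w p)) = (\<Prod>d<D. \<Prod>n<N. word_prob K \<theta> d (w (d, n)))"
    by (subst prod.cartesian_product) (auto intro!: prod.cong)
  finally show ?thesis .
qed

lemma hellinger_sq:
  fixes V :: nat
  shows "(hellinger (count_space {..<V}) p q)\<^sup>2 = (\<Sum>v<V. (sqrt (p v) - sqrt (q v))\<^sup>2)"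
proof -
  have "(\<integral>x. (sqrt (p x) - sqrt (q x))\<^sup>2 \<partial>count_space {..<V}) = (\<Sum>v<V. (sqrt (p v) - sqrt (q v))\<^sup>2)"
    by (rule lebesgue_integral_count_space_finite) simp
  then show ?thesis by (simp add: hellinger_def sum_nonneg)
qed

subsection \<open>The competitor\<close>

text \<open>One truth at one sample size; all bounds proved here are explicit in its data, so that
  the constants stay uniform along a sequence. N \<ge> 2 keeps the relative error 1 / N at most 1 /
  2.\<close>

locale lda_truth =
  fixes K V D N :: nat and \<gamma> \<beta> :: "nat \<Rightarrow> nat \<Rightarrow> real" and \<delta> c :: real
  assumes K: "0 < K" and V: "0 < V" and D: "0 < D" and N: "2 \<le> N" and \<delta>: "0 < \<delta>" and c: "1 < c"
    and \<gamma>: "\<And>d. d < D \<Longrightarrow> \<gamma> d \<in> prob_simplex K"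
      "\<And>d k. d < D \<Longrightarrow> k < K \<Longrightarrow> \<gamma> d k \<noteq> 0 \<Longrightarrow> \<delta> \<le> \<gamma> d k"
    and \<beta>: "\<And>k. k < K \<Longrightarrow> \<beta> k \<in> prob_simplex V"
      "\<And>k v. k < K \<Longrightarrow> v < V \<Longrightarrow> \<beta> k v \<noteq> 0 \<Longrightarrow> \<delta> \<le> \<beta> k v"
begin

abbreviation I :: "(nat \<times> nat) set" where "I \<equiv> {..<D} \<times> {..<N}"
abbreviation P :: "nat \<Rightarrow> nat \<Rightarrow> real" where "P \<equiv> word_prob K (\<gamma>, \<beta>)"
abbreviation "DK \<equiv> dirichlet K (1 / real K powr c)"
abbreviation "DV \<equiv> dirichlet V (1 / real V powr c)"
abbreviation "base \<equiv> lda_base c K V D N"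

text \<open>The relative error 1 / N makes the loss over all D N positions a factor depending on D
  alone, at a price of ln N per support component in the prior mass.\<close>

definition Ag :: "nat \<Rightarrow> (nat \<Rightarrow> real) set" where "Ag d = lower_box K (1 / real N) (\<gamma> d)"
definition Ab :: "nat \<Rightarrow> (nat \<Rightarrow> real) set" where "Ab k = lower_box V (1 / real N) (\<beta> k)"
definition mass :: real where "mass = (\<Prod>d<D. measure DK (Ag d)) * (\<Prod>k<K. measure DV (Ab k))"
definition deviation :: "(nat \<times> nat \<Rightarrow> nat) \<Rightarrow> real" where
  "deviation w = (\<Sum>d<D. \<Sum>v | v < V \<and> 0 < P d v.
     (real (card {n. n < N \<and> w (d, n) = v}) - real N * P d v)\<^sup>2 / (real N * P d v))"
text \<open>An almost sure event under the truth, see \<open>good_data\<close>. On it the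
  responsibilities are well defined and the likelihood of the truth is positive.\<close>

definition good :: "(nat \<times> nat \<Rightarrow> nat) \<Rightarrow> bool" where
  "good w \<longleftrightarrow> (\<forall>p\<in>I. w p < V \<and> 0 < P (fst p) (w p))"
definition truth_lik :: "(nat \<times> nat \<Rightarrow> nat) \<Rightarrow> real" where
  "truth_lik w = (\<Prod>d<D. \<Prod>n<N. P d (w (d, n)))"
text \<open>The responsibility \<open>resp w p k\<close> is the posterior probability under the truth that position \<open>p\<close>
  has topic \<open>k\<close>.\<close>

definition resp :: "(nat \<times> nat \<Rightarrow> nat) \<Rightarrow> nat \<times> nat \<Rightarrow> nat \<Rightarrow> real" where
  "resp w p k = \<gamma> (fst p) k * \<beta> k (w p) / P (fst p) (w p)"
definition q0 :: "(nat \<times> nat \<Rightarrow> nat) \<Rightarrow> (lda_param \<times> (nat \<times> nat \<Rightarrow> nat)) measure" where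
  "q0 w = (Pi\<^sub>M {..<D} (\<lambda>d. density DK (\<lambda>x. ennreal (indicator (Ag d) x / measure DK (Ag d))))
      \<Otimes>\<^sub>M Pi\<^sub>M {..<K} (\<lambda>k. density DV (\<lambda>x. ennreal (indicator (Ab k) x / measure DV (Ab k)))))
      \<Otimes>\<^sub>M Pi\<^sub>M I (\<lambda>p. density (count_space {..<K}) (\<lambda>k. ennreal (resp w p k)))"
definition f0 :: "(nat \<times> nat \<Rightarrow> nat) \<Rightarrow> lda_param \<times> (nat \<times> nat \<Rightarrow> nat) \<Rightarrow> real" where
  "f0 w x = (\<Prod>d<D. indicator (Ag d) (fst (fst x) d) / measure DK (Ag d))
     * (\<Prod>k<K. indicator (Ab k) (snd (fst x) k) / measure DV (Ab k))
     * (\<Prod>p\<in>I. resp w p (snd x p))"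

text \<open>As c > 1, the total Dirichlet parameter \<open>m * m powr (- c)\<close> is at most 1,
  which \<open>dirichlet_lower_box_ge\<close> asks for.\<close>

lemma hyper: "0 < 1 / real K powr c" "real K * (1 / real K powr c) \<le> 1"
  "0 < 1 / real V powr c" "real V * (1 / real V powr c) \<le> 1"
proof -
  have "real m * (1 / real m powr c) \<le> 1" if "0 < m" for m :: nat
  proof -
    have "real m powr 1 \<le> real m powr c" using c that by (intro powr_mono) auto
    then show ?thesis using that by (simp add: field_simps)
  qed
  then show "0 < 1 / real K powr c" "real K * (1 / real K powr c) \<le> 1"
    "0 < 1 / real V powr c" "real V * (1 / real V powr c) \<le> 1" using K V by auto
qed

sublocale DK: prob_space DK using K hyper by (intro prob_space_dirichlet) auto
sublocale DV: prob_space DV using V hyper by (intro prob_space_dirichlet) auto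

lemma measure_Ag_ge:
  assumes "d < D"
  shows "1 / (2 * real K) * (1 / real K powr c * (1 / real N * \<delta>) / 2) ^ card {k. k < K \<and> \<gamma> d k \<noteq> 0} * (1 / real N * \<delta> / (2 * real K))
    \<le> measure DK (Ag d)"
proof -
  have "ennreal (1 / (2 * real K) * (1 / real K powr c * (1 / real N * \<delta>) / 2) ^ card {k. k < K \<and> \<gamma> d k \<noteq> 0} * (1 / real N * \<delta> / (2 * real K)))
    \<le> emeasure DK (Ag d)"
    unfolding Ag_def using K N \<delta> hyper \<gamma> assms by (intro dirichlet_lower_box_ge) auto
  then show ?thesis by (simp add: DK.emeasure_eq_measure)
qed

lemma measure_Ab_ge:
  assumes "k < K"
  shows "1 / (2 * real V) * (1 / real V powr c * (1 / real N * \<delta>) / 2) ^ card {v. v < V \<and> \<beta> k v \<noteq> 0} * (1 / real N * \<delta> / (2 * real V))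
    \<le> measure DV (Ab k)"
proof -
  have "ennreal (1 / (2 * real V) * (1 / real V powr c * (1 / real N * \<delta>) / 2) ^ card {v. v < V \<and> \<beta> k v \<noteq> 0} * (1 / real N * \<delta> / (2 * real V)))
    \<le> emeasure DV (Ab k)"
    unfolding Ab_def using V N \<delta> hyper \<beta> assms by (intro dirichlet_lower_box_ge) auto
  then show ?thesis by (simp add: DV.emeasure_eq_measure)
qed

lemma measure_Ag_pos: "d < D \<Longrightarrow> 0 < measure DK (Ag d)"
  by (rule less_le_trans[OF _ measure_Ag_ge]) (use K N \<delta> in auto)

lemma measure_Ab_pos: "k < K \<Longrightarrow> 0 < measure DV (Ab k)"
  by (rule less_le_trans[OF _ measure_Ab_ge]) (use V N \<delta> in auto)

lemma mass_pos: "0 < mass" and mass_le_1: "mass \<le> 1"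
proof -
  show "0 < mass" unfolding mass_def
    by (intro mult_pos_pos prod_pos) (auto intro: measure_Ag_pos measure_Ab_pos)
  show "mass \<le> 1" unfolding mass_def
    by (intro mult_le_one prod_le_1 prod_nonneg) auto
qed

lemma P_nonneg: "d < D \<Longrightarrow> v < V \<Longrightarrow> 0 \<le> P d v"
  using \<gamma> \<beta> by (intro word_prob_nonneg) auto

lemma sum_P: "d < D \<Longrightarrow> (\<Sum>v<V. P d v) = 1"
  using \<gamma> \<beta> by (intro sum_word_prob) auto

lemma P_le_1: "d < D \<Longrightarrow> v < V \<Longrightarrow> P d v \<le> 1"
  using member_le_sum[of v "{..<V}" "P d"] P_nonneg sum_P[of d] by auto

lemma product_nonneg: "d < D \<Longrightarrow> k < K \<Longrightarrow> v < V \<Longrightarrow> 0 \<le> \<gamma> d k * \<beta> k v"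
  using \<gamma>(1)[of d] \<beta>(1)[of k] by (intro mult_nonneg_nonneg) (auto simp: prob_simplex_def)

lemma prob_space_mean_field:
  assumes "q \<in> mean_field K V D N"
  shows "prob_space q" "sets q = sets base"
proof -
  obtain qg qb qz where q: "q = (Pi\<^sub>M {..<D} qg \<Otimes>\<^sub>M Pi\<^sub>M {..<K} qb) \<Otimes>\<^sub>M Pi\<^sub>M I qz"
    and m: "\<forall>d<D. qg d \<in> space (prob_algebra (simplex_space K))" "\<forall>k<K. qb k \<in> space (prob_algebra (simplex_space V))"
      "\<forall>d<D. \<forall>n<N. qz (d, n) \<in> space (prob_algebra (count_space {..<K}))"
    using assms unfolding mean_field_def by blast
  interpret G: prob_space "Pi\<^sub>M {..<D} qg" using m by (intro prob_space_PiM) (auto simp: space_prob_algebra)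
  interpret B: prob_space "Pi\<^sub>M {..<K} qb" using m by (intro prob_space_PiM) (auto simp: space_prob_algebra)
  interpret Z: prob_space "Pi\<^sub>M I qz" using m by (intro prob_space_PiM) (auto simp: space_prob_algebra)
  interpret GB: pair_prob_space "Pi\<^sub>M {..<D} qg" "Pi\<^sub>M {..<K} qb" ..
  interpret Q: pair_prob_space "Pi\<^sub>M {..<D} qg \<Otimes>\<^sub>M Pi\<^sub>M {..<K} qb" "Pi\<^sub>M I qz" ..
  show "prob_space q" unfolding q by (rule Q.prob_space_axioms)
  show "sets q = sets base" unfolding q sets_lda_base lda_param_space_def
    using m by (intro sets_pair_measure_cong sets_PiM_cong) (auto simp: space_prob_algebra)
qed

context
  fixes w assumes w: "good w"
begin

lemma wV: "p \<in> I \<Longrightarrow> w p < V" and wP: "p \<in> I \<Longrightarrow> 0 < P (fst p) (w p)"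
  using w by (auto simp: good_def)

lemma resp_nonneg: "p \<in> I \<Longrightarrow> k < K \<Longrightarrow> 0 \<le> resp w p k"
  unfolding resp_def using wV[of p] wP[of p] by (intro divide_nonneg_nonneg product_nonneg) auto

lemma prob_space_resp: "p \<in> I \<Longrightarrow> prob_space (density (count_space {..<K}) (\<lambda>k. ennreal (resp w p k)))"
proof
  assume p: "p \<in> I"
  have "(\<Sum>k<K. resp w p k) = 1"
    using wP[OF p] unfolding resp_def sum_divide_distrib[symmetric] by (simp add: word_prob_def)
  then have "(\<Sum>k<K. ennreal (resp w p k)) = 1"
    using resp_nonneg[OF p] by (subst sum_ennreal) auto
  then show "emeasure (density (count_space {..<K}) (\<lambda>k. ennreal (resp w p k)))
      (space (density (count_space {..<K}) (\<lambda>k. ennreal (resp w p k)))) = 1"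
    by (simp add: emeasure_density nn_integral_count_space_finite cong: nn_integral_cong)
qed

lemma prob_space_restricted:
  "d < D \<Longrightarrow> prob_space (density DK (\<lambda>x. ennreal (indicator (Ag d) x / measure DK (Ag d))))"
  "k < K \<Longrightarrow> prob_space (density DV (\<lambda>x. ennreal (indicator (Ab k) x / measure DV (Ab k))))"
  using measure_Ag_pos measure_Ab_pos
  by (auto intro!: prob_space_density_indicator DK.prob_space_axioms DV.prob_space_axioms simp: Ag_def Ab_def lower_box_sets)

lemma q0_mem: "q0 w \<in> mean_field K V D N"
  unfolding mean_field_def q0_def
  by (intro CollectI exI conjI refl allI impI)
    (auto simp only: space_prob_algebra mem_Collect_eq sets_density sets_dirichlet
      intro!: prob_space_restricted prob_space_resp)

text \<open>Densities multiply across the three independent blocks. The product of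
  \<open>ennreal\<close> values agrees with \<open>ennreal (f0 w x)\<close> on the space only, where
  assignments are below \<open>K\<close> and hence responsibilities are nonnegative.\<close>

lemma q0_density: "q0 w = density base (\<lambda>x. ennreal (f0 w x))"
proof -
  let ?g = "\<lambda>d x. ennreal (indicator (Ag d) x / measure DK (Ag d))"
  let ?b = "\<lambda>k x. ennreal (indicator (Ab k) x / measure DV (Ab k))"
  let ?z = "\<lambda>p k. ennreal (resp w p k)"
  let ?P1 = "Pi\<^sub>M {..<D} (\<lambda>_. DK)" and ?P2 = "Pi\<^sub>M {..<K} (\<lambda>_. DV)" and ?P3 = "Pi\<^sub>M I (\<lambda>_. count_space {..<K})"
  let ?F1 = "\<lambda>x. \<Prod>d<D. ?g d (x d)" and ?F2 = "\<lambda>x. \<Prod>k<K. ?b k (x k)" and ?F3 = "\<lambda>z. \<Prod>p\<in>I. ?z p (z p)"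
  have gm: "?g d \<in> borel_measurable DK" "?b k \<in> borel_measurable DV" for d k
    by (auto intro!: measurable_compose[OF _ measurable_ennreal] borel_measurable_divide borel_measurable_indicator
        simp: Ag_def Ab_def lower_box_sets)
  have psf: "sigma_finite_measure M" if "prob_space M" for M :: "'x measure"
    using that by (simp add: prob_space_imp_sigma_finite)
  have 1: "Pi\<^sub>M {..<D} (\<lambda>d. density DK (?g d)) = density ?P1 ?F1"
    using gm prob_space_restricted DK.sigma_finite_measure_axioms by (intro PiM_density_on) (auto intro: psf)
  have 2: "Pi\<^sub>M {..<K} (\<lambda>k. density DV (?b k)) = density ?P2 ?F2"
    using gm prob_space_restricted DV.sigma_finite_measure_axioms by (intro PiM_density_on) (auto intro: psf)
  have 3: "Pi\<^sub>M I (\<lambda>p. density (count_space {..<K}) (?z p)) = density ?P3 ?F3"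
    using prob_space_resp by (intro PiM_density_on) (auto intro: psf sigma_finite_measure_count_space_finite)
  have m1: "?F1 \<in> borel_measurable ?P1"
    by (rule borel_measurable_prod_ennreal, rule measurable_compose[OF _ gm(1)], rule measurable_component_singleton)
  have m2: "?F2 \<in> borel_measurable ?P2"
    by (rule borel_measurable_prod_ennreal, rule measurable_compose[OF _ gm(2)], rule measurable_component_singleton)
  have m3: "?F3 \<in> borel_measurable ?P3"
    by (rule borel_measurable_prod_ennreal, rule measurable_compose[where N="count_space {..<K}"],
        rule measurable_component_singleton) simp_all
  have p2: "prob_space ?P2" by (intro prob_space_PiM DV.prob_space_axioms)
  have p2': "prob_space (density ?P2 ?F2)" unfolding 2[symmetric] by (intro prob_space_PiM prob_space_restricted) auto
  interpret Z: product_sigma_finite "\<lambda>_ :: nat \<times> nat. count_space {..<K}"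
    by (simp add: product_sigma_finite_def sigma_finite_measure_count_space_finite)
  have p3: "sigma_finite_measure ?P3" by (rule Z.sigma_finite) simp
  have p3': "prob_space (density ?P3 ?F3)" unfolding 3[symmetric] by (intro prob_space_PiM prob_space_resp)
  have mp: "(\<lambda>(x, y). ?F1 x * ?F2 y) \<in> borel_measurable (?P1 \<Otimes>\<^sub>M ?P2)"
    using m1 m2 by (auto intro!: borel_measurable_times_ennreal simp: split_beta intro: measurable_compose[OF measurable_fst] measurable_compose[OF measurable_snd])
  have "q0 w = density ((?P1 \<Otimes>\<^sub>M ?P2) \<Otimes>\<^sub>M ?P3) (\<lambda>(x, z). (case x of (g, b) \<Rightarrow> ?F1 g * ?F2 b) * ?F3 z)"
    unfolding q0_def 1 2 3
    by (subst pair_measure_density[OF m1 m2 psf[OF p2] psf[OF p2']], rule pair_measure_density[OF mp m3 p3 psf[OF p3']])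
  also have "\<dots> = density base (\<lambda>x. ennreal (f0 w x))"
    unfolding lda_base_def lda_prior_def
  proof (intro density_cong)
    have sp: "snd x p < K" if "x \<in> space ((?P1 \<Otimes>\<^sub>M ?P2) \<Otimes>\<^sub>M ?P3)" "p \<in> I" for x p
      using that by (cases p) (auto simp: space_pair_measure space_PiM PiE_iff)
    have eq: "(case x of (x, z) \<Rightarrow> (case x of (g, b) \<Rightarrow> ?F1 g * ?F2 b) * ?F3 z) = ennreal (f0 w x)"
      if x: "x \<in> space ((?P1 \<Otimes>\<^sub>M ?P2) \<Otimes>\<^sub>M ?P3)" for x
    proof -
      have "0 \<le> (\<Prod>d<D. indicator (Ag d) (fst (fst x) d) / measure DK (Ag d) :: real)"
        "0 \<le> (\<Prod>k<K. indicator (Ab k) (snd (fst x) k) / measure DV (Ab k) :: real)"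
        by (auto intro!: prod_nonneg)
      then show ?thesis using resp_nonneg sp[OF x]
        by (simp add: f0_def split_beta ennreal_mult prod_ennreal prod_nonneg)
    qed
    show M: "(\<lambda>(x, z). (case x of (g, b) \<Rightarrow> ?F1 g * ?F2 b) * ?F3 z) \<in> borel_measurable ((?P1 \<Otimes>\<^sub>M ?P2) \<Otimes>\<^sub>M ?P3)"
      using measurable_compose[OF measurable_fst[of "?P1 \<Otimes>\<^sub>M ?P2" ?P3] mp]
        measurable_compose[OF measurable_snd[of "?P1 \<Otimes>\<^sub>M ?P2" ?P3] m3]
      by (simp add: split_beta' borel_measurable_times_ennreal)
    show "(\<lambda>x. ennreal (f0 w x)) \<in> borel_measurable ((?P1 \<Otimes>\<^sub>M ?P2) \<Otimes>\<^sub>M ?P3)"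
      using M by (subst measurable_cong[OF eq[symmetric]]) auto
    show "AE x in (?P1 \<Otimes>\<^sub>M ?P2) \<Otimes>\<^sub>M ?P3. (case x of (x, z) \<Rightarrow> (case x of (g, b) \<Rightarrow> ?F1 g * ?F2 b) * ?F3 z) = ennreal (f0 w x)"
      using eq by (intro AE_I2) auto
  qed
  finally show ?thesis .
qed

end

end

section \<open>Exponential moment of the loss, and domination of the competitor by the
  likelihood\<close>

context lda_truth
begin

text \<open>The sum of the squared Hellinger distances, scaled by the exponent that
  \<open>likelihood_ratio_bound\<close> leaves; it is the test function for
  \<open>Donsker_Varadhan\<close>.\<close>

definition loss :: "lda_param \<Rightarrow> real" where
  "loss \<theta> = real N / 2 * (\<Sum>d<D. \<Sum>v<V. (sqrt (word_prob K \<theta> d v) - sqrt (P d v))\<^sup>2)"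

lemma loss_measurable: "loss \<in> borel_measurable (lda_param_space K V D)"
proof -
  have "(\<lambda>\<theta>. (sqrt (word_prob K \<theta> d v) - sqrt (P d v))\<^sup>2) \<in> borel_measurable (lda_param_space K V D)" if "d < D" for d v
  proof -
    note word_prob_measurable[OF that, measurable]
    show ?thesis by measurable
  qed
  then show ?thesis unfolding loss_def[abs_def]
    by (intro borel_measurable_times borel_measurable_sum borel_measurable_const) auto
qed

lemma loss_nonneg: "0 \<le> loss \<theta>"
  by (simp add: loss_def sum_nonneg)

lemma space_paramD:
  assumes "\<theta> \<in> space (lda_param_space K V D)"
  shows "d < D \<Longrightarrow> fst \<theta> d \<in> prob_simplex K" "k < K \<Longrightarrow> snd \<theta> k \<in> prob_simplex V"
  using assms by (auto simp: space_lda_param_space PiE_iff)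

text \<open>With x = 1 / N, ln(1 - x) \<ge> - x - 2 x^2, and x \<le> 1 / 2 turns 2 x^2 into at most
  x.\<close>

lemma one_minus_inverse_N_ge: "exp (- 2 / real N) \<le> 1 - 1 / real N"
proof -
  let ?x = "1 / real N"
  have x: "0 \<le> ?x" "?x \<le> 1 / 2" using N by auto
  have "?x * ?x \<le> ?x * (1 / 2)" using x by (intro mult_left_mono) auto
  then have "- 2 * ?x \<le> - ?x - 2 * ?x\<^sup>2" by (simp add: power2_eq_square)
  also have "\<dots> \<le> ln (1 - ?x)" using x by (intro ln_one_minus_pos_lower_bound) auto
  finally have "exp (- 2 * ?x) \<le> exp (ln (1 - ?x))" by simp
  then show ?thesis using x by simp
qed

context
  fixes w assumes w: "good w"
begin

lemma truth_lik_alt: "truth_lik w = (\<Prod>p\<in>I. P (fst p) (w p))"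
  unfolding truth_lik_def by (subst prod.cartesian_product) (auto intro!: prod.cong)

lemma truth_lik_pos: "0 < truth_lik w"
  unfolding truth_lik_alt by (intro prod_pos wP[OF w])

lemma lik_times_exp_loss_le:
  assumes \<theta>: "\<theta> \<in> space (lda_param_space K V D)"
  shows "exp (loss \<theta>) * (\<Prod>d<D. \<Prod>n<N. word_prob K \<theta> d (w (d, n))) \<le> truth_lik w * exp (2 * deviation w)"
proof -
  let ?h = "\<lambda>d. \<Sum>v<V. (sqrt (word_prob K \<theta> d v) - sqrt (P d v))\<^sup>2"
  let ?X = "\<lambda>d. \<Sum>v | v < V \<and> 0 < P d v.
     (real (card {n. n < N \<and> w (d, n) = v}) - real N * P d v)\<^sup>2 / (real N * P d v)"
  have "exp (loss \<theta>) = (\<Prod>d<D. exp (real N / 2 * ?h d))"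
    by (simp add: loss_def exp_sum sum_distrib_left)
  then have "exp (loss \<theta>) * (\<Prod>d<D. \<Prod>n<N. word_prob K \<theta> d (w (d, n)))
      = (\<Prod>d<D. (\<Prod>n<N. word_prob K \<theta> d (w (d, n))) * exp (real N / 2 * ?h d))"
    by (simp add: prod.distrib)
  also have "\<dots> \<le> (\<Prod>d<D. (\<Prod>n<N. P d (w (d, n))) * exp (2 * ?X d))"
  proof (rule prod_mono)
    fix d assume d: "d \<in> {..<D}"
    have nn: "0 \<le> word_prob K \<theta> d v" if "v < V" for v
      using space_paramD[OF \<theta>] d that by (intro word_prob_nonneg) auto
    have ws: "w (d, n) < V \<and> 0 < P d (w (d, n))" if "n < N" for n
      using wV[OF w, of "(d, n)"] wP[OF w, of "(d, n)"] d that by auto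
    have "0 \<le> (\<Prod>n<N. word_prob K \<theta> d (w (d, n))) * exp (real N / 2 * ?h d)"
      using nn ws by (intro mult_nonneg_nonneg prod_nonneg) auto
    moreover have "(\<Prod>n<N. word_prob K \<theta> d (w (d, n))) * exp (real N / 2 * ?h d)
        \<le> (\<Prod>n<N. P d (w (d, n))) * exp (2 * ?X d)"
    proof (rule likelihood_ratio_bound)
      show "(\<Sum>v<V. word_prob K \<theta> d v) = 1" using space_paramD[OF \<theta>] d by (intro sum_word_prob) auto
    qed (use nn ws d N P_nonneg sum_P in auto)
    ultimately show "0 \<le> (\<Prod>n<N. word_prob K \<theta> d (w (d, n))) * exp (real N / 2 * ?h d) \<and>
       (\<Prod>n<N. word_prob K \<theta> d (w (d, n))) * exp (real N / 2 * ?h d) \<le> (\<Prod>n<N. P d (w (d, n))) * exp (2 * ?X d)" ..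
  qed
  also have "\<dots> = truth_lik w * exp (2 * deviation w)"
    by (simp add: prod.distrib truth_lik_def deviation_def exp_sum sum_distrib_left)
  finally show ?thesis .
qed

text \<open>The pointwise bound is uniform in \<theta>, so the prior, a probability measure,
  integrates it at no cost. Divided by the evidence this is the exponential moment of the loss under
  the posterior.\<close>

lemma nn_integral_exp_loss_lik_le:
  "(\<integral>\<^sup>+x. ennreal (exp (loss (fst x))) * ennreal (lda_complete_lik D N w x) \<partial>base)
    \<le> ennreal (truth_lik w * exp (2 * deviation w))"
proof -
  let ?Z = "Pi\<^sub>M I (\<lambda>_. count_space {..<K})"
  interpret Z: product_sigma_finite "\<lambda>_ :: nat \<times> nat. count_space {..<K}"
    by (simp add: product_sigma_finite_def sigma_finite_measure_count_space_finite)
  interpret S: sigma_finite_measure ?Z by (rule Z.sigma_finite) simp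
  interpret prior: prob_space "lda_prior c K V D" using K V by (rule prob_space_lda_prior)
  have lm: "loss \<in> borel_measurable (lda_prior c K V D)"
    by (subst measurable_cong_sets[OF sets_lda_prior refl]) (rule loss_measurable)
  have "(\<lambda>x. ennreal (exp (loss (fst x)))) \<in> borel_measurable (lda_prior c K V D \<Otimes>\<^sub>M ?Z)"
    by (rule measurable_compose[OF measurable_compose[OF measurable_fst lm]]) simp
  moreover have lik: "(\<lambda>x. ennreal (lda_complete_lik D N w x)) \<in> borel_measurable (lda_prior c K V D \<Otimes>\<^sub>M ?Z)"
    using lda_complete_lik_measurable[of D N w c K V] by (simp add: lda_base_def)
  ultimately have m: "(\<lambda>x. ennreal (exp (loss (fst x))) * ennreal (lda_complete_lik D N w x)) \<in> borel_measurable (lda_prior c K V D \<Otimes>\<^sub>M ?Z)"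
    by (rule borel_measurable_times_ennreal)
  have "(\<integral>\<^sup>+x. ennreal (exp (loss (fst x))) * ennreal (lda_complete_lik D N w x) \<partial>base)
     = (\<integral>\<^sup>+\<theta>. (\<integral>\<^sup>+z. ennreal (exp (loss \<theta>)) * ennreal (lda_complete_lik D N w (\<theta>, z)) \<partial>?Z) \<partial>lda_prior c K V D)"
    unfolding lda_base_def by (subst S.nn_integral_fst[OF m, symmetric]) simp
  also have "\<dots> \<le> (\<integral>\<^sup>+\<theta>. ennreal (truth_lik w * exp (2 * deviation w)) \<partial>lda_prior c K V D)"
  proof (intro nn_integral_mono)
    fix \<theta> assume "\<theta> \<in> space (lda_prior c K V D)"
    then have \<theta>: "\<theta> \<in> space (lda_param_space K V D)" by (simp add: space_lda_prior)
    have "(\<lambda>z. ennreal (lda_complete_lik D N w (\<theta>, z))) \<in> borel_measurable ?Z"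
      using \<theta> by (intro measurable_compose[OF _ lik] measurable_Pair1') (simp add: space_lda_prior)
    then have "(\<integral>\<^sup>+z. ennreal (exp (loss \<theta>)) * ennreal (lda_complete_lik D N w (\<theta>, z)) \<partial>?Z)
        = ennreal (exp (loss \<theta>)) * ennreal (\<Prod>d<D. \<Prod>n<N. word_prob K \<theta> d (w (d, n)))"
      using nn_integral_assignments[OF \<theta>, of N w] wV[OF w] by (simp add: nn_integral_cmult)
    also have "\<dots> = ennreal (exp (loss \<theta>) * (\<Prod>d<D. \<Prod>n<N. word_prob K \<theta> d (w (d, n))))"
      by (simp add: ennreal_mult')
    also have "\<dots> \<le> ennreal (truth_lik w * exp (2 * deviation w))"
      by (intro ennreal_leI lik_times_exp_loss_le \<theta>)
    finally show "(\<integral>\<^sup>+z. ennreal (exp (loss \<theta>)) * ennreal (lda_complete_lik D N w (\<theta>, z)) \<partial>?Z)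
       \<le> ennreal (truth_lik w * exp (2 * deviation w))" .
  qed
  also have "\<dots> = ennreal (truth_lik w * exp (2 * deviation w))"
    by (simp add: prior.emeasure_space_1)
  finally show ?thesis .
qed

text \<open>On the support of the competitor: its density has a simple form; responsibility times
  word probability is \<open>\<gamma> * \<beta>\<close>, and these factors are matched from below by
  the box up to \<open>1 - 1 / N\<close> each; and the responsibilities are bounded away from 0,
  which will supply the L of \<open>kl_div_density_le\<close>.\<close>

lemma f0_support:
  assumes x: "x \<in> space base" and nz: "f0 w x \<noteq> 0"
  shows "f0 w x = (\<Prod>p\<in>I. resp w p (snd x p)) / mass"
    and "(\<Prod>p\<in>I. resp w p (snd x p)) * truth_lik w * exp (- 4 * real D) \<le> lda_complete_lik D N w x"
    and "(\<delta> * \<delta>) ^ card I \<le> (\<Prod>p\<in>I. resp w p (snd x p))"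
proof -
  have A: "\<And>d. d < D \<Longrightarrow> fst (fst x) d \<in> Ag d" "\<And>k. k < K \<Longrightarrow> snd (fst x) k \<in> Ab k"
    and R: "\<And>p. p \<in> I \<Longrightarrow> resp w p (snd x p) \<noteq> 0"
    using nz by (auto simp: f0_def indicator_def split: if_splits)
  show "f0 w x = (\<Prod>p\<in>I. resp w p (snd x p)) / mass"
    using A by (simp add: f0_def mass_def prod_dividef)
  have zK: "snd x p < K" if "p \<in> I" for p
    using x that by (cases p) (auto simp: space_lda_base PiE_iff)
  have nz': "\<gamma> (fst p) (snd x p) \<noteq> 0" "\<beta> (snd x p) (w p) \<noteq> 0" if "p \<in> I" for p
    using R[OF that] by (auto simp: resp_def)
  show "(\<delta> * \<delta>) ^ card I \<le> (\<Prod>p\<in>I. resp w p (snd x p))"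
  proof -
    have "(\<Prod>p\<in>I. \<delta> * \<delta>) \<le> (\<Prod>p\<in>I. resp w p (snd x p))"
    proof (intro prod_mono conjI)
      fix p assume p: "p \<in> I"
      then have fp: "fst p < D" by auto
      have "\<delta> * \<delta> \<le> \<gamma> (fst p) (snd x p) * \<beta> (snd x p) (w p)"
        using \<gamma>(2)[OF fp zK[OF p]] \<beta>(2)[OF zK[OF p] wV[OF w p]] nz'[OF p] \<delta> by (intro mult_mono) auto
      also have "\<dots> = \<gamma> (fst p) (snd x p) * \<beta> (snd x p) (w p) / 1" by simp
      also have "\<dots> \<le> resp w p (snd x p)" unfolding resp_def
        using P_le_1[OF fp wV[OF w p]] wP[OF w p] product_nonneg[OF fp zK[OF p] wV[OF w p]]
        by (intro divide_left_mono) auto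
      finally show "\<delta> * \<delta> \<le> resp w p (snd x p)" .
    qed (use \<delta> in auto)
    then show ?thesis by simp
  qed
  show "(\<Prod>p\<in>I. resp w p (snd x p)) * truth_lik w * exp (- 4 * real D) \<le> lda_complete_lik D N w x"
  proof -
    \<comment> \<open>The constant is spread over the D N positions, one factor
      \<open>exp (- 2 / real N)\<close> for the topic proportion and one for the word
      proportion.\<close>
    have "exp (- 4 * real D) = (\<Prod>p\<in>I. exp (- 2 / real N) * exp (- 2 / real N))"
    proof -
      have "(\<Prod>p\<in>I. exp (- 2 / real N) * exp (- 2 / real N)) = exp (- 4 / real N) ^ (D * N)"
        by (simp add: exp_add[symmetric])
      also have "\<dots> = exp (real (D * N) * (- 4 / real N))" by (rule exp_of_nat_mult[symmetric])
      also have "real (D * N) * (- 4 / real N) = - 4 * real D" using N by simp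
      finally show ?thesis ..
    qed
    then have "(\<Prod>p\<in>I. resp w p (snd x p)) * truth_lik w * exp (- 4 * real D)
       = (\<Prod>p\<in>I. resp w p (snd x p) * P (fst p) (w p) * (exp (- 2 / real N) * exp (- 2 / real N)))"
      by (simp only: truth_lik_alt prod.distrib)
    also have "\<dots> \<le> (\<Prod>p\<in>I. fst (fst x) (fst p) (snd x p) * snd (fst x) (snd x p) (w p))"
    proof (intro prod_mono conjI)
      fix p assume p: "p \<in> I"
      then have fp: "fst p < D" by auto
      note pp = wP[OF w p] and vV = wV[OF w p] and kK = zK[OF p]
      let ?a = "\<gamma> (fst p) (snd x p)" and ?b = "\<beta> (snd x p) (w p)" and ?e = "exp (- 2 / real N)"
      have ab: "0 \<le> ?a" "0 \<le> ?b" using \<gamma>(1)[OF fp] \<beta>(1)[OF kK] kK vV by (auto simp: prob_simplex_def)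
      have r: "resp w p (snd x p) * P (fst p) (w p) = ?a * ?b" using pp by (simp add: resp_def)
      show "0 \<le> resp w p (snd x p) * P (fst p) (w p) * (?e * ?e)" unfolding r using ab by simp
      have "?e * ?a \<le> (1 - 1 / real N) * ?a" by (intro mult_right_mono one_minus_inverse_N_ge ab)
      also have "\<dots> \<le> fst (fst x) (fst p) (snd x p)"
        using A(1)[OF fp] kK by (auto simp: Ag_def lower_box_def)
      finally have 1: "?e * ?a \<le> fst (fst x) (fst p) (snd x p)" .
      have "?e * ?b \<le> (1 - 1 / real N) * ?b" by (intro mult_right_mono one_minus_inverse_N_ge ab)
      also have "\<dots> \<le> snd (fst x) (snd x p) (w p)"
        using A(2)[OF kK] vV by (auto simp: Ab_def lower_box_def)
      finally have 2: "?e * ?b \<le> snd (fst x) (snd x p) (w p)" .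
      have "resp w p (snd x p) * P (fst p) (w p) * (?e * ?e) = (?e * ?a) * (?e * ?b)" unfolding r by simp
      also have "\<dots> \<le> fst (fst x) (fst p) (snd x p) * snd (fst x) (snd x p) (w p)"
      proof (rule mult_mono[OF 1 2])
        show "0 \<le> fst (fst x) (fst p) (snd x p)" using 1 ab by (meson exp_ge_zero mult_nonneg_nonneg order_trans)
      qed (use ab in simp)
      finally show "resp w p (snd x p) * P (fst p) (w p) * (?e * ?e)
        \<le> fst (fst x) (fst p) (snd x p) * snd (fst x) (snd x p) (w p)" .
    qed
    finally show ?thesis by (simp add: lda_complete_lik_alt)
  qed
qed

lemma f0_nonneg: "x \<in> space base \<Longrightarrow> 0 \<le> f0 w x"
proof -
  assume x: "x \<in> space base"
  have "snd x p < K" if "p \<in> I" for p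
    using x that by (cases p) (auto simp: space_lda_base PiE_iff)
  then show ?thesis unfolding f0_def
    by (intro mult_nonneg_nonneg prod_nonneg ballI resp_nonneg[OF w]) auto
qed

text \<open>A pointwise domination, stronger than a bound in mean. It yields the upper bound on the
  divergence of the competitor, and also the positivity of the evidence.\<close>

lemma f0_le:
  assumes x: "x \<in> space base"
  shows "f0 w x \<le> exp (4 * real D) / (truth_lik w * mass) * lda_complete_lik D N w x"
proof (cases "f0 w x = 0")
  case True
  then show ?thesis using lda_complete_lik_bounds(1)[OF x wV[OF w]] truth_lik_pos mass_pos by simp
next
  case False
  note S = f0_support[OF x False]
  have "f0 w x = exp (4 * real D) / (truth_lik w * mass) * ((\<Prod>p\<in>I. resp w p (snd x p)) * truth_lik w * exp (- 4 * real D))"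
    using truth_lik_pos mass_pos by (simp add: S(1) exp_minus field_simps)
  also have "\<dots> \<le> exp (4 * real D) / (truth_lik w * mass) * lda_complete_lik D N w x"
    using truth_lik_pos mass_pos by (intro mult_left_mono S(2)) auto
  finally show ?thesis .
qed

lemma f0_measurable: "f0 w \<in> borel_measurable base"
proof -
  let ?M = "lda_param_space K V D \<Otimes>\<^sub>M Pi\<^sub>M I (\<lambda>_. count_space {..<K})"
  have 1: "(\<lambda>x. indicator (Ag d) (fst (fst x) d) / measure DK (Ag d) :: real) \<in> borel_measurable ?M" if "d < D" for d
  proof (intro borel_measurable_divide borel_measurable_const)
    have m: "(\<lambda>x. fst (fst x) d) \<in> measurable ?M (simplex_space K)"
      unfolding lda_param_space_def
      by (rule measurable_compose[OF measurable_fst], rule measurable_compose[OF measurable_fst measurable_component_singleton]) (use that in simp)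
    show "(\<lambda>x. indicator (Ag d) (fst (fst x) d) :: real) \<in> borel_measurable ?M"
      by (rule measurable_compose[OF m borel_measurable_indicator]) (simp add: Ag_def lower_box_sets)
  qed
  have 2: "(\<lambda>x. indicator (Ab k) (snd (fst x) k) / measure DV (Ab k) :: real) \<in> borel_measurable ?M" if "k < K" for k
  proof (intro borel_measurable_divide borel_measurable_const)
    have m: "(\<lambda>x. snd (fst x) k) \<in> measurable ?M (simplex_space V)"
      unfolding lda_param_space_def
      by (rule measurable_compose[OF measurable_fst], rule measurable_compose[OF measurable_snd measurable_component_singleton]) (use that in simp)
    show "(\<lambda>x. indicator (Ab k) (snd (fst x) k) :: real) \<in> borel_measurable ?M"
      by (rule measurable_compose[OF m borel_measurable_indicator]) (simp add: Ab_def lower_box_sets)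
  qed
  have 3: "(\<lambda>x. resp w p (snd x p)) \<in> borel_measurable ?M" if "p \<in> I" for p
    by (rule measurable_compose[OF measurable_compose[OF measurable_snd measurable_component_singleton[OF that]]]) simp
  have "f0 w \<in> borel_measurable ?M"
    unfolding f0_def[abs_def] using 1 2 3 by (intro borel_measurable_times borel_measurable_prod) auto
  then show ?thesis by (subst measurable_cong_sets[OF sets_lda_base refl])
qed

end

end

subsection \<open>The risk of the variational solution\<close>

context lda_truth
begin

text \<open>Each squared Hellinger distance is at most 2. Boundedness makes the loss integrable
  under every member of the mean-field family.\<close>

lemma loss_le:
  assumes "\<theta> \<in> space (lda_param_space K V D)"
  shows "loss \<theta> \<le> real N * real D"
proof -
  have "(\<Sum>v<V. (sqrt (word_prob K \<theta> d v) - sqrt (P d v))\<^sup>2) \<le> 2" if d: "d < D" for d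
  proof -
    have wp: "0 \<le> word_prob K \<theta> d v" if "v < V" for v
      using space_paramD[OF assms] d that by (intro word_prob_nonneg) auto
    have "(\<Sum>v<V. (sqrt (word_prob K \<theta> d v) - sqrt (P d v))\<^sup>2) \<le> (\<Sum>v<V. word_prob K \<theta> d v + P d v)"
    proof (rule sum_mono)
      fix v assume "v \<in> {..<V}"
      then have "0 \<le> word_prob K \<theta> d v" "0 \<le> P d v" using wp P_nonneg[OF d] by auto
      then show "(sqrt (word_prob K \<theta> d v) - sqrt (P d v))\<^sup>2 \<le> word_prob K \<theta> d v + P d v"
        by (simp add: power2_diff)
    qed
    also have "\<dots> = 2" using space_paramD[OF assms] d by (simp add: sum.distrib sum_P sum_word_prob)
    finally show ?thesis .
  qed
  then have "(\<Sum>d<D. \<Sum>v<V. (sqrt (word_prob K \<theta> d v) - sqrt (P d v))\<^sup>2) \<le> (\<Sum>d<D. 2)"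
    by (intro sum_mono) auto
  then have "loss \<theta> \<le> real N / 2 * (real D * 2)"
    unfolding loss_def by (intro mult_left_mono) auto
  then show ?thesis by simp
qed

lemma lda_hellinger_risk_eq:
  assumes "sets q = sets base"
  shows "lda_hellinger_risk K V D (\<gamma>, \<beta>) (theta_marginal K V D q) = 2 / (real N * real D) * (\<integral>x. loss (fst x) \<partial>q)"
proof -
  have m: "fst \<in> measurable q (lda_param_space K V D)"
    by (subst measurable_cong_sets[OF assms refl], subst measurable_cong_sets[OF sets_lda_base refl]) (rule measurable_fst)
  have eq: "(\<Sum>d<D. (hellinger (count_space {..<V}) (word_prob K \<theta> d) (P d))\<^sup>2) / real D = 2 / (real N * real D) * loss \<theta>" for \<theta>
    unfolding hellinger_sq loss_def using N D by simp
  show ?thesis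
    unfolding lda_hellinger_risk_def theta_marginal_def eq
    using integral_distr[OF m, of "\<lambda>\<theta>. 2 / (real N * real D) * loss \<theta>"] loss_measurable by simp
qed

context
  fixes w assumes w: "good w"
begin

abbreviation "lik \<equiv> lda_complete_lik D N w"

definition ev :: real where "ev = enn2real (lda_evidence c K V D N w)"

text \<open>Finite because \<open>exp (loss \<theta>)\<close> is at least 1, so the exponential
  moment dominates the evidence. Positive because the competitor has total mass 1 and its density is
  at most a constant times the likelihood.\<close>

lemma evidence: "lda_evidence c K V D N w = ennreal ev" "0 < ev"
proof -
  have "lda_evidence c K V D N w \<le> (\<integral>\<^sup>+x. ennreal (exp (loss (fst x))) * ennreal (lik x) \<partial>base)"
    unfolding lda_evidence_def
  proof (intro nn_integral_mono)
    fix x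
    have "1 * ennreal (lik x) \<le> ennreal (exp (loss (fst x))) * ennreal (lik x)"
      using loss_nonneg by (intro mult_right_mono) auto
    then show "ennreal (lik x) \<le> ennreal (exp (loss (fst x))) * ennreal (lik x)" by simp
  qed
  also have "\<dots> \<le> ennreal (truth_lik w * exp (2 * deviation w))" by (rule nn_integral_exp_loss_lik_le[OF w])
  finally have "lda_evidence c K V D N w < \<infinity>" by (simp add: order_le_less_trans)
  then show e: "lda_evidence c K V D N w = ennreal ev" by (simp add: ev_def)
  interpret q0: prob_space "q0 w" by (rule prob_space_mean_field[OF q0_mem[OF w]])
  let ?C = "exp (4 * real D) / (truth_lik w * mass)"
  have C: "0 \<le> ?C" using truth_lik_pos[OF w] mass_pos by simp
  have fm: "(\<lambda>x. ennreal (f0 w x)) \<in> borel_measurable base" using f0_measurable[OF w] by simp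
  have lm: "(\<lambda>x. ennreal (lik x)) \<in> borel_measurable base"
    by (rule measurable_compose[OF lda_complete_lik_measurable measurable_ennreal])
  have "1 = emeasure (q0 w) (space (q0 w))" by (simp add: q0.emeasure_space_1)
  also have "\<dots> = (\<integral>\<^sup>+x. ennreal (f0 w x) \<partial>base)"
    unfolding q0_density[OF w] using fm by (simp add: emeasure_density cong: nn_integral_cong)
  also have "\<dots> \<le> (\<integral>\<^sup>+x. ennreal ?C * ennreal (lik x) \<partial>base)"
    unfolding ennreal_mult'[OF C, symmetric] by (intro nn_integral_mono ennreal_leI f0_le[OF w])
  also have "\<dots> = ennreal ?C * ennreal ev"
    using lm by (simp add: nn_integral_cmult e[symmetric] lda_evidence_def)
  finally show "0 < ev" by (cases "0 < ev") (auto simp: ennreal_neg)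
qed

lemma posterior_eq: "lda_posterior c K V D N w = density base (\<lambda>x. ennreal (lik x / ev))"
  unfolding lda_posterior_def evidence(1)
proof (intro density_cong AE_I2)
  show "ennreal (lik x) / ennreal ev = ennreal (lik x / ev)" if "x \<in> space base" for x
    using lda_complete_lik_bounds(1)[OF that wV[OF w]] evidence(2) by (rule divide_ennreal)
  show "(\<lambda>x. ennreal (lik x) / ennreal ev) \<in> borel_measurable base"
    by (intro borel_measurable_divide_ennreal measurable_compose[OF lda_complete_lik_measurable measurable_ennreal] measurable_const) simp
  show "(\<lambda>x. ennreal (lik x / ev)) \<in> borel_measurable base"
    by (intro measurable_compose[OF _ measurable_ennreal] borel_measurable_divide lda_complete_lik_measurable borel_measurable_const)
qed

lemma lik_ev_measurable: "(\<lambda>x. ennreal (lik x / ev)) \<in> borel_measurable base"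
  by (intro measurable_compose[OF _ measurable_ennreal] borel_measurable_divide lda_complete_lik_measurable borel_measurable_const)

lemma prob_space_posterior: "prob_space (lda_posterior c K V D N w)"
proof
  have "emeasure (lda_posterior c K V D N w) (space (lda_posterior c K V D N w)) = (\<integral>\<^sup>+x. ennreal (lik x / ev) \<partial>base)"
    unfolding posterior_eq using lik_ev_measurable by (simp add: emeasure_density cong: nn_integral_cong)
  also have "\<dots> = (\<integral>\<^sup>+x. ennreal (1 / ev) * ennreal (lik x) \<partial>base)"
    using evidence(2) by (intro nn_integral_cong) (simp add: ennreal_mult'[symmetric])
  also have "\<dots> = ennreal (1 / ev) * lda_evidence c K V D N w"
    unfolding lda_evidence_def
    by (rule nn_integral_cmult) (rule measurable_compose[OF lda_complete_lik_measurable measurable_ennreal])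
  also have "\<dots> = 1" using evidence by (simp add: ennreal_mult'[symmetric])
  finally show "emeasure (lda_posterior c K V D N w) (space (lda_posterior c K V D N w)) = 1" .
qed

lemma kl_div_q0_le:
  "kl_div (q0 w) (lda_posterior c K V D N w) \<le> ereal (ln (exp (4 * real D) / (truth_lik w * mass) * ev))"
proof -
  define F where "F x = f0 w x * ev / lik x" for x
  have Fm: "F \<in> borel_measurable base"
    unfolding F_def[abs_def]
    by (intro borel_measurable_divide borel_measurable_times f0_measurable[OF w] lda_complete_lik_measurable borel_measurable_const)
  have lik0: "0 \<le> lik x" if "x \<in> space base" for x
    by (rule lda_complete_lik_bounds(1)[OF that wV[OF w]])
  \<comment> \<open>By \<open>f0_le\<close> the competitor's density vanishes wherever the
    likelihood does, so the value 0 of F given by division by zero is the right one.\<close>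
  have likpos: "0 < lik x" if "x \<in> space base" "f0 w x \<noteq> 0" for x
  proof -
    have "0 < f0 w x" using f0_nonneg[OF w that(1)] that(2) by simp
    with f0_le[OF w that(1)] have "0 < exp (4 * real D) / (truth_lik w * mass) * lik x" by linarith
    then show ?thesis using lik0[OF that(1)] by (cases "lik x = 0") auto
  qed
  have q: "q0 w = density (lda_posterior c K V D N w) (\<lambda>x. ennreal (F x))"
  proof -
    have "density (lda_posterior c K V D N w) (\<lambda>x. ennreal (F x)) = density base (\<lambda>x. ennreal (lik x / ev) * ennreal (F x))"
      unfolding posterior_eq using Fm lik_ev_measurable by (intro density_density_eq) auto
    also have "\<dots> = density base (\<lambda>x. ennreal (f0 w x))"
    proof (intro density_cong AE_I2)
      fix x assume x: "x \<in> space base"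
      have "ennreal (lik x / ev) * ennreal (F x) = ennreal (lik x / ev * F x)"
        using lik0[OF x] evidence(2) by (intro ennreal_mult'[symmetric]) simp
      also have "lik x / ev * F x = f0 w x"
        using likpos[OF x] evidence(2) by (cases "f0 w x = 0") (auto simp: F_def)
      finally show "ennreal (lik x / ev) * ennreal (F x) = ennreal (f0 w x)" .
    qed (use Fm lik_ev_measurable f0_measurable[OF w] in \<open>auto intro!: borel_measurable_times_ennreal\<close>)
    finally show ?thesis unfolding q0_density[OF w] ..
  qed
  \<comment> \<open>The lower bound combines the third part of \<open>f0_support\<close> with mass
    and likelihood being at most 1; it only secures integrability of the log density.\<close>
  have "AE x in base. 0 < ennreal (f0 w x) \<longrightarrow> (\<delta> * \<delta>) ^ card I * ev \<le> F x \<and> F x \<le> exp (4 * real D) / (truth_lik w * mass) * ev"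
  proof (intro AE_I2 impI conjI)
    fix x assume x: "x \<in> space base" and f: "0 < ennreal (f0 w x)"
    then have nz: "f0 w x \<noteq> 0" by auto
    note S = f0_support[OF w x nz] and lp = likpos[OF x nz]
    have "(\<delta> * \<delta>) ^ card I * ev \<le> (\<Prod>p\<in>I. resp w p (snd x p)) * ev" using S(3) evidence(2) by (intro mult_right_mono) auto
    also have "\<dots> \<le> (\<Prod>p\<in>I. resp w p (snd x p)) / mass * ev"
    proof -
      have "0 \<le> (\<Prod>p\<in>I. resp w p (snd x p))" by (rule order_trans[OF _ S(3)]) simp
      then have "(\<Prod>p\<in>I. resp w p (snd x p)) * mass \<le> (\<Prod>p\<in>I. resp w p (snd x p)) * 1"
        using mass_le_1 by (intro mult_left_mono) auto
      then have "(\<Prod>p\<in>I. resp w p (snd x p)) \<le> (\<Prod>p\<in>I. resp w p (snd x p)) / mass"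
        using mass_pos by (simp add: pos_le_divide_eq)
      then show ?thesis using evidence(2) by (intro mult_right_mono) auto
    qed
    also have "\<dots> = f0 w x * ev" by (simp add: S(1))
    also have "\<dots> = f0 w x * ev / 1" by simp
    also have "\<dots> \<le> F x" unfolding F_def
      using lda_complete_lik_bounds(2)[OF x wV[OF w]] lp f0_nonneg[OF w x] evidence(2) by (intro divide_left_mono) auto
    finally show "(\<delta> * \<delta>) ^ card I * ev \<le> F x" .
    have "F x = f0 w x / lik x * ev" by (simp add: F_def)
    also have "\<dots> \<le> exp (4 * real D) / (truth_lik w * mass) * ev"
      using f0_le[OF w x] lp evidence(2) by (intro mult_right_mono) (auto simp: pos_divide_le_eq)
    finally show "F x \<le> exp (4 * real D) / (truth_lik w * mass) * ev" .
  qed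
  then have AE: "AE x in q0 w. (\<delta> * \<delta>) ^ card I * ev \<le> F x \<and> F x \<le> exp (4 * real D) / (truth_lik w * mass) * ev"
    unfolding q0_density[OF w] using f0_measurable[OF w] by (subst AE_density) auto
  show ?thesis
    by (rule kl_div_density_le[OF prob_space_posterior prob_space_mean_field(1)[OF q0_mem[OF w]] _ q AE])
      (use Fm \<delta> evidence(2) in \<open>auto simp: posterior_eq\<close>)
qed

text \<open>A minimiser has no larger divergence than the competitor. In the sum of that divergence
  bound and the log exponential moment, \<open>ev\<close> and \<open>truth_lik w\<close>
  cancel.\<close>

lemma risk_bound:
  assumes q: "lda_variational_solution c K V D N w q"
  shows "lda_hellinger_risk K V D (\<gamma>, \<beta>) (theta_marginal K V D q)
    \<le> 2 / (real N * real D) * (4 * real D - ln mass + 2 * deviation w)"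
proof -
  let ?p = "lda_posterior c K V D N w"
  have qm: "q \<in> mean_field K V D N" and "\<not> kl_div (q0 w) ?p < kl_div q ?p"
    using q q0_mem[OF w] by (auto simp: lda_variational_solution_def is_arg_min_def)
  then have kl: "kl_div q ?p \<le> ereal (ln (exp (4 * real D) / (truth_lik w * mass) * ev))"
    using kl_div_q0_le by (meson not_less order_trans)
  note Q = prob_space_mean_field[OF qm]
  have sp: "sets ?p = sets base" by (simp add: lda_posterior_def)
  have lm: "(\<lambda>x. loss (fst x)) \<in> borel_measurable base"
    by (subst measurable_cong_sets[OF sets_lda_base refl]) (rule measurable_compose[OF measurable_fst loss_measurable])
  have lp: "(\<lambda>x. loss (fst x)) \<in> borel_measurable ?p" using lm by (subst measurable_cong_sets[OF sp refl])
  interpret q: prob_space q by (rule Q(1))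
  have int: "integrable q (\<lambda>x. loss (fst x))"
  proof (rule q.integrable_const_bound)
    have "norm (loss (fst x)) \<le> real N * real D" if "x \<in> space q" for x
    proof -
      have "fst x \<in> space (lda_param_space K V D)"
        using that unfolding sets_eq_imp_space_eq[OF Q(2)] by (auto simp: space_lda_base)
      then show ?thesis using loss_le loss_nonneg by simp
    qed
    then show "AE x in q. norm (loss (fst x)) \<le> real N * real D" by (intro AE_I2)
    show "(\<lambda>x. loss (fst x)) \<in> borel_measurable q" using lm by (subst measurable_cong_sets[OF Q(2) refl])
  qed
  have el: "(\<lambda>x. ennreal (exp (loss (fst x)))) \<in> borel_measurable base"
    by (rule measurable_compose[OF lm]) simp
  have "(\<integral>\<^sup>+x. ennreal (exp (loss (fst x))) \<partial>?p) = (\<integral>\<^sup>+x. ennreal (lik x / ev) * ennreal (exp (loss (fst x))) \<partial>base)"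
    unfolding posterior_eq by (rule nn_integral_density[OF lik_ev_measurable el])
  also have "\<dots> = (\<integral>\<^sup>+x. ennreal (1 / ev) * (ennreal (exp (loss (fst x))) * ennreal (lik x)) \<partial>base)"
    using lda_complete_lik_bounds(1)[OF _ wV[OF w]] evidence(2)
    by (intro nn_integral_cong) (simp add: ennreal_mult'[symmetric] ennreal_mult''[symmetric] mult.commute)
  also have "\<dots> = ennreal (1 / ev) * (\<integral>\<^sup>+x. ennreal (exp (loss (fst x))) * ennreal (lik x) \<partial>base)"
    by (intro nn_integral_cmult borel_measurable_times_ennreal el measurable_compose[OF lda_complete_lik_measurable measurable_ennreal])
  also have "\<dots> \<le> ennreal (1 / ev) * ennreal (truth_lik w * exp (2 * deviation w))"
    by (intro mult_left_mono nn_integral_exp_loss_lik_le[OF w]) simp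
  also have "\<dots> = ennreal (truth_lik w * exp (2 * deviation w) / ev)"
    using evidence(2) by (simp add: ennreal_mult'[symmetric])
  finally have M: "(\<integral>\<^sup>+x. ennreal (exp (loss (fst x))) \<partial>?p) \<le> ennreal (truth_lik w * exp (2 * deviation w) / ev)" .
  have "(\<integral>x. loss (fst x) \<partial>q) \<le> ln (exp (4 * real D) / (truth_lik w * mass) * ev) + ln (truth_lik w * exp (2 * deviation w) / ev)"
    using truth_lik_pos[OF w] evidence(2)
    by (intro Donsker_Varadhan[OF prob_space_posterior Q(1) _ kl lp int M]) (auto simp: Q(2) sp)
  also have "\<dots> = 4 * real D - ln mass + 2 * deviation w"
    using truth_lik_pos[OF w] evidence(2) mass_pos by (simp add: ln_mult ln_div)
  finally show ?thesis
    unfolding lda_hellinger_risk_eq[OF Q(2)] by (intro mult_left_mono) auto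
qed

end

end

subsection \<open>Concentration and conclusion\<close>

text \<open>N \<ge> 3 > e gives L \<ge> 1, so constants can be charged to L. Each support component
  costs at most c + 2 + |ln \<delta>| times L. The part outside the power costs 5 + |ln \<delta>|
  times L once, and is charged to the support through s \<ge> 1.\<close>

lemma neg_ln_box_mass_le:
  fixes x L c \<delta> :: real
  assumes m: "1 \<le> m" and N: "3 \<le> N" and s: "1 \<le> s" and \<delta>: "0 < \<delta>" and c: "1 < c"
    and L: "ln (real m) \<le> L" "ln (real N) \<le> L"
    and x: "1 / (2 * real m) * (1 / real m powr c * (1 / real N * \<delta>) / 2) ^ s * (1 / real N * \<delta> / (2 * real m)) \<le> x"
  shows "- ln x \<le> real s * L * (7 + c + 2 * \<bar>ln \<delta>\<bar>)"
proof -
  let ?l = "\<bar>ln \<delta>\<bar>"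
  have "exp 1 \<le> (3 :: real)" by (rule exp_le)
  also have "3 \<le> real N" using N by simp
  finally have "1 \<le> ln (real N)" using N by (subst ln_ge_iff) auto
  with L have L1: "1 \<le> L" by simp
  have l2: "ln 2 \<le> L" using ln_2_less_1 L1 by simp
  have lm: "0 \<le> ln (real m)" using m by simp
  have y0: "0 < 1 / (2 * real m) * (1 / real m powr c * (1 / real N * \<delta>) / 2) ^ s * (1 / real N * \<delta> / (2 * real m))"
    using m N \<delta> by simp
  have ln4: "ln (4 :: real) = 2 * ln 2" using ln_realpow[of 2 2] by simp
  have "ln (1 / (2 * real m) * (1 / real m powr c * (1 / real N * \<delta>) / 2) ^ s * (1 / real N * \<delta> / (2 * real m)))
     = - (ln 2 + ln (real m)) + real s * (- c * ln (real m) + (- ln (real N) + ln \<delta>) - ln 2) + (- ln (real N) + ln \<delta> - (ln 2 + ln (real m)))"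
    using m N \<delta> ln4 by (simp add: ln_mult ln_div ln_realpow ln_powr algebra_simps)
  moreover have "ln (1 / (2 * real m) * (1 / real m powr c * (1 / real N * \<delta>) / 2) ^ s * (1 / real N * \<delta> / (2 * real m))) \<le> ln x"
    using x y0 by (subst ln_le_cancel_iff) auto
  ultimately have "- ln x \<le> real s * (c * ln (real m) + ln (real N) - ln \<delta> + ln 2) + (2 * ln 2 + 2 * ln (real m) + ln (real N) - ln \<delta>)"
    by (simp add: algebra_simps)
  also have "\<dots> \<le> real s * (L * (c + 2 + ?l)) + real s * (L * (5 + ?l))"
  proof (rule add_mono)
    have a: "?l \<le> L * ?l" using L1 mult_right_mono[of 1 L ?l] by simp
    have b: "c * ln (real m) \<le> c * L" using L(1) c by (intro mult_left_mono) auto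
    show "real s * (c * ln (real m) + ln (real N) - ln \<delta> + ln 2) \<le> real s * (L * (c + 2 + ?l))"
    proof (rule mult_left_mono)
      have "L * (c + 2 + ?l) = c * L + 2 * L + L * ?l" by (simp add: algebra_simps)
      then show "c * ln (real m) + ln (real N) - ln \<delta> + ln 2 \<le> L * (c + 2 + ?l)" using a b L l2 by linarith
    qed simp
    have "2 * ln 2 + 2 * ln (real m) + ln (real N) - ln \<delta> \<le> L * (5 + ?l)"
    proof -
      have "L * (5 + ?l) = 5 * L + L * ?l" by (simp add: algebra_simps)
      then show ?thesis using a L l2 by linarith
    qed
    also have "\<dots> = 1 * (L * (5 + ?l))" by simp
    also have "\<dots> \<le> real s * (L * (5 + ?l))" using s L1 by (intro mult_right_mono) auto
    finally show "2 * ln 2 + 2 * ln (real m) + ln (real N) - ln \<delta> \<le> real s * (L * (5 + ?l))" .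
  qed
  also have "\<dots> = real s * L * (7 + c + 2 * ?l)" by (simp add: algebra_simps)
  finally show ?thesis .
qed

text \<open>Makes every sparsity level at least 1, so that terms of order D or K can be charged to
  the sparsity sums.\<close>

lemma support_card_pos:
  assumes "x \<in> prob_simplex m" "0 < m"
  shows "1 \<le> card {i. i < m \<and> x i \<noteq> 0}"
proof -
  obtain j where "j < m" "x j \<noteq> 0" using prob_simplex_nonempty[OF assms] by blast
  then have "{i. i < m \<and> x i \<noteq> 0} \<noteq> {}" by auto
  then show ?thesis by (simp add: Suc_le_eq card_gt_0_iff)
qed

section \<open>The chi-square deviation under the truth, and the final finite-sample bound\<close>

context lda_truth
begin

abbreviation "data \<equiv> lda_data_pmf K V D N (\<gamma>, \<beta>)"
abbreviation "word d \<equiv> bind_pmf (cat_pmf K (\<gamma> d)) (\<lambda>k. cat_pmf V (\<beta> k))"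

lemma data_alt: "data = Pi_pmf I 0 (\<lambda>p. word (fst p))"
  by (simp add: lda_data_pmf_def split_beta')

lemma pmf_word_truth: "d < D \<Longrightarrow> pmf (word d) v = (if v < V then P d v else 0)"
  using pmf_word[of "(\<gamma>, \<beta>)" d K V v] \<gamma> \<beta> by simp

lemma set_wordD: "d < D \<Longrightarrow> v \<in> set_pmf (word d) \<Longrightarrow> v < V \<and> P d v \<noteq> 0"
  unfolding set_pmf_iff pmf_word_truth by (auto split: if_splits)

lemma finite_set_word: "d < D \<Longrightarrow> finite (set_pmf (word d))"
  by (rule finite_subset[of _ "{..<V}"], rule subsetI, drule (1) set_wordD) simp_all

lemma good_data: "w \<in> set_pmf data \<Longrightarrow> good w"
proof -
  assume "w \<in> set_pmf data"
  then have "w p \<in> set_pmf (word (fst p))" if "p \<in> I" for p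
    using that by (auto simp: data_alt set_Pi_pmf PiE_dflt_def)
  then have "w p < V \<and> P (fst p) (w p) \<noteq> 0" if "p \<in> I" for p
    using that by (intro set_wordD) auto
  then show ?thesis
    using P_nonneg by (fastforce simp: good_def less_le)
qed

text \<open>A positive word probability has a nonzero summand, and both factors of that summand are
  at least \<delta>.\<close>

lemma P_ge: "d < D \<Longrightarrow> v < V \<Longrightarrow> 0 < P d v \<Longrightarrow> \<delta> * \<delta> \<le> P d v"
proof -
  assume d: "d < D" and v: "v < V" and pos: "0 < P d v"
  have "\<exists>k<K. \<gamma> d k * \<beta> k v \<noteq> 0"
  proof (rule ccontr)
    assume "\<not> ?thesis"
    then have "P d v = 0" unfolding word_prob_def by (intro sum.neutral) auto
    with pos show False by simp
  qed
  then obtain k where k: "k < K" "\<gamma> d k \<noteq> 0" "\<beta> k v \<noteq> 0" by auto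
  have "\<delta> * \<delta> \<le> \<gamma> d k * \<beta> k v" using \<gamma>(2)[OF d k(1,2)] \<beta>(2)[OF k(1) v k(3)] \<delta> by (intro mult_mono) auto
  also have "\<dots> \<le> P d v" unfolding word_prob_def fst_conv snd_conv
    using k(1) product_nonneg[OF d _ v] by (intro member_le_sum[of k "{..<K}" "\<lambda>k. \<gamma> d k * \<beta> k v"]) auto
  finally show ?thesis .
qed

lemma card_support_le: "d < D \<Longrightarrow> real (card {v. v < V \<and> 0 < P d v}) \<le> 1 / (\<delta> * \<delta>)"
proof -
  assume d: "d < D"
  have "real (card {v. v < V \<and> 0 < P d v}) * (\<delta> * \<delta>) = (\<Sum>v | v < V \<and> 0 < P d v. \<delta> * \<delta>)" by simp
  also have "\<dots> \<le> (\<Sum>v | v < V \<and> 0 < P d v. P d v)" using P_ge[OF d] by (intro sum_mono) auto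
  also have "\<dots> \<le> (\<Sum>v<V. P d v)" using P_nonneg[OF d] by (intro sum_mono2) auto
  finally show ?thesis using sum_P[OF d] \<delta> by (simp add: field_simps)
qed

lemma finite_set_data: "finite (set_pmf data)"
  unfolding data_alt by (rule finite_set_Pi_pmf) (auto intro: finite_set_word simp del: set_bind_pmf)

text \<open>A chi-square term is a binomial variance N P (1 - P) divided by N P, so its mean is 1 -
  P. There are at most 1 / \<delta>^2 such terms per document, whatever the vocabulary size.\<close>

lemma expectation_deviation_le: "measure_pmf.expectation data deviation \<le> real D / (\<delta> * \<delta>)"
proof -
  have int: "integrable data f" for f :: "_ \<Rightarrow> real"
    by (rule integrable_measure_pmf_finite[OF finite_set_data])
  let ?E = "measure_pmf.expectation data"
  have one: "?E (\<lambda>w. (real (card {n. n < N \<and> w (d, n) = v}) - real N * P d v)\<^sup>2 / (real N * P d v)) \<le> 1"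
    if d: "d < D" and v: "v < V" "0 < P d v" for d v
  proof -
    have cd: "card {n. n < N \<and> w (d, n) = v} = card {x \<in> {d} \<times> {..<N}. w x = v}" for w :: "nat \<times> nat \<Rightarrow> nat"
    proof -
      have "{x \<in> {d} \<times> {..<N}. w x = v} = Pair d ` {n. n < N \<and> w (d, n) = v}" by auto
      then show ?thesis by (simp add: card_image inj_on_def)
    qed
    have "?E (\<lambda>w. (real (card {x \<in> {d} \<times> {..<N}. w x = v}) - real (card ({d} \<times> {..<N})) * pmf (word d) v)\<^sup>2)
       = real (card ({d} \<times> {..<N})) * pmf (word d) v * (1 - pmf (word d) v)"
      unfolding data_alt using d by (intro expectation_count_deviation) (auto intro: finite_set_word simp del: set_bind_pmf)
    then have E: "?E (\<lambda>w. (real (card {n. n < N \<and> w (d, n) = v}) - real N * P d v)\<^sup>2) = real N * P d v * (1 - P d v)"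
      using d v by (simp add: cd pmf_word_truth card_cartesian_product)
    have "?E (\<lambda>w. (real (card {n. n < N \<and> w (d, n) = v}) - real N * P d v)\<^sup>2 / (real N * P d v)) = 1 - P d v"
      using E v N by simp
    then show ?thesis using v by simp
  qed
  have "?E deviation = (\<Sum>d<D. \<Sum>v | v < V \<and> 0 < P d v.
      ?E (\<lambda>w. (real (card {n. n < N \<and> w (d, n) = v}) - real N * P d v)\<^sup>2 / (real N * P d v)))"
    unfolding deviation_def[abs_def] by (simp only: Bochner_Integration.integral_sum[OF int])
  also have "\<dots> \<le> (\<Sum>d<D. \<Sum>v | v < V \<and> 0 < P d v. 1)"
    using one by (intro sum_mono) auto
  also have "\<dots> = (\<Sum>d<D. real (card {v. v < V \<and> 0 < P d v}))" by simp
  also have "\<dots> \<le> (\<Sum>d<D. 1 / (\<delta> * \<delta>))" using card_support_le by (intro sum_mono) auto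
  finally show ?thesis by simp
qed

lemma deviation_nonneg: "0 \<le> deviation w"
  unfolding deviation_def by (intro sum_nonneg divide_nonneg_nonneg) auto

text \<open>Markov's inequality; intersecting with the support of the data law adds
  \<open>good\<close> for free.\<close>

lemma prob_good_ge:
  assumes t: "0 < t"
  shows "1 - 1 / (\<delta> * \<delta> * t) \<le> measure_pmf.prob data {w. good w \<and> deviation w \<le> real D * t}"
proof -
  have Dt: "0 < real D * t" using D t by simp
  have "measure_pmf.prob data {w \<in> space data. real D * t \<le> deviation w} \<le> measure_pmf.expectation data deviation / (real D * t)"
    by (rule integral_Markov_inequality_measure[where A="{}"])
      (use integrable_measure_pmf_finite[OF finite_set_data] deviation_nonneg Dt in auto)
  also have "\<dots> \<le> (real D / (\<delta> * \<delta>)) / (real D * t)"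
    using expectation_deviation_le Dt by (intro divide_right_mono) auto
  also have "\<dots> = 1 / (\<delta> * \<delta> * t)" using D by simp
  finally have B: "measure_pmf.prob data {w. real D * t \<le> deviation w} \<le> 1 / (\<delta> * \<delta> * t)" by simp
  have "1 - measure_pmf.prob data {w. real D * t \<le> deviation w} = measure_pmf.prob data (- {w. real D * t \<le> deviation w})"
    using measure_pmf.prob_compl[of "{w. real D * t \<le> deviation w}" data] by (simp add: Compl_eq_Diff_UNIV)
  also have "\<dots> = measure_pmf.prob data (- {w. real D * t \<le> deviation w} \<inter> set_pmf data)"
    by (rule measure_Int_set_pmf[symmetric])
  also have "\<dots> \<le> measure_pmf.prob data {w. good w \<and> deviation w \<le> real D * t}"
    using good_data by (intro measure_pmf.finite_measure_mono) auto
  finally show ?thesis using B by simp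
qed

lemma risk_bound_sparse:
  fixes e dk :: "nat \<Rightarrow> nat"
  assumes N3: "3 \<le> N" and e: "\<And>d. d < D \<Longrightarrow> m_sparse K (e d) (\<gamma> d)" and dk: "\<And>k. k < K \<Longrightarrow> m_sparse V (dk k) (\<beta> k)"
    and w: "good w" and dev: "deviation w \<le> real D * ln (real N)"
    and q: "lda_variational_solution c K V D N w q"
  shows "lda_hellinger_risk K V D (\<gamma>, \<beta>) (theta_marginal K V D q)
    \<le> 2 * (13 + c + 2 * \<bar>ln \<delta>\<bar>) * (real (\<Sum>d<D. e d) / (real D * real N) * ln (real D * real K * real N)
        + real (\<Sum>k<K. dk k) / (real D * real N) * ln (real K * real V * real N))"
proof -
  let ?C = "7 + c + 2 * \<bar>ln \<delta>\<bar>"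
  let ?L1 = "ln (real D * real K * real N)" and ?L2 = "ln (real K * real V * real N)"
  have mono: "ln (real a) \<le> ln (real b)" if "0 < a" "a \<le> b" for a b :: nat using that by simp
  have L1: "ln (real K) \<le> ?L1" "ln (real N) \<le> ?L1" using mono[of K "D * K * N"] mono[of N "D * K * N"] K D N by (auto simp: Suc_le_eq)
  have L2: "ln (real V) \<le> ?L2" "ln (real N) \<le> ?L2" using mono[of V "K * V * N"] mono[of N "K * V * N"] K V N by (auto simp: Suc_le_eq)
  have "exp 1 \<le> (3 :: real)" by (rule exp_le)
  also have "3 \<le> real N" using N3 by simp
  finally have lnN: "1 \<le> ln (real N)" using N by (subst ln_ge_iff) auto
  have C0: "0 \<le> ?C" using c by simp
  have e1: "1 \<le> e d" if "d < D" for d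
    using e[OF that] support_card_pos[OF \<gamma>(1)[OF that] K] by (simp add: m_sparse_def)
  have g: "- ln (measure DK (Ag d)) \<le> real (e d) * ?L1 * ?C" if "d < D" for d
  proof -
    have "- ln (measure DK (Ag d)) \<le> real (card {k. k < K \<and> \<gamma> d k \<noteq> 0}) * ?L1 * ?C"
      by (rule neg_ln_box_mass_le[OF _ N3 _ \<delta> c L1 measure_Ag_ge[OF that]])
        (use K support_card_pos[OF \<gamma>(1)[OF that] K] in auto)
    also have "\<dots> \<le> real (e d) * ?L1 * ?C"
      using e[OF that] L1 lnN C0 by (intro mult_right_mono) (auto simp: m_sparse_def)
    finally show ?thesis .
  qed
  have b: "- ln (measure DV (Ab k)) \<le> real (dk k) * ?L2 * ?C" if "k < K" for k
  proof -
    have "- ln (measure DV (Ab k)) \<le> real (card {v. v < V \<and> \<beta> k v \<noteq> 0}) * ?L2 * ?C"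
      by (rule neg_ln_box_mass_le[OF _ N3 _ \<delta> c L2 measure_Ab_ge[OF that]])
        (use V support_card_pos[OF \<beta>(1)[OF that] V] in auto)
    also have "\<dots> \<le> real (dk k) * ?L2 * ?C"
      using dk[OF that] L2 lnN C0 by (intro mult_right_mono) (auto simp: m_sparse_def)
    finally show ?thesis .
  qed
  let ?A = "real (\<Sum>d<D. e d) * ?L1" and ?B = "real (\<Sum>k<K. dk k) * ?L2"
  have "- ln mass = (\<Sum>d<D. - ln (measure DK (Ag d))) + (\<Sum>k<K. - ln (measure DV (Ab k)))"
  proof -
    have "ln mass = ln (\<Prod>d<D. measure DK (Ag d)) + ln (\<Prod>k<K. measure DV (Ab k))"
      unfolding mass_def using measure_Ag_pos measure_Ab_pos by (intro ln_mult_pos prod_pos) auto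
    also have "\<dots> = (\<Sum>d<D. ln (measure DK (Ag d))) + (\<Sum>k<K. ln (measure DV (Ab k)))"
      using measure_Ag_pos measure_Ab_pos by (subst (1 2) ln_prod) (auto, force+)
    finally show ?thesis by (simp add: sum_negf)
  qed
  also have "\<dots> \<le> (\<Sum>d<D. real (e d) * ?L1 * ?C) + (\<Sum>k<K. real (dk k) * ?L2 * ?C)"
    using g b by (intro add_mono sum_mono) auto
  also have "\<dots> = ?A * ?C + ?B * ?C" by (simp add: sum_distrib_right)
  finally have m: "- ln mass \<le> ?A * ?C + ?B * ?C" .
  \<comment> \<open>Every e_d is at least 1, so the allowance for the deviation is within the first
    term of the rate.\<close>
  have "real D * ln (real N) \<le> ?A"
  proof (rule mult_mono)
    have "(\<Sum>d<D. 1) \<le> (\<Sum>d<D. e d)" using e1 by (intro sum_mono) auto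
    then show "real D \<le> real (\<Sum>d<D. e d)" by (simp only: of_nat_le_iff sum_constant card_lessThan) simp
  qed (use L1 lnN in \<open>auto intro!: sum_nonneg\<close>)
  moreover have "real D \<le> real D * ln (real N)" using mult_left_mono[OF lnN, of "real D"] by simp
  moreover have "0 \<le> ?B" using L2 lnN by (intro mult_nonneg_nonneg) (auto intro!: sum_nonneg)
  \<comment> \<open>The term 4 D costs four times \<open>?A\<close> and twice the deviation another
    two, whence 13 = 7 + 6; the matching \<open>6 * ?B\<close> is added to obtain a common
    factor.\<close>
  ultimately have "4 * real D - ln mass + 2 * deviation w \<le> (?A * ?C + ?B * ?C) + 6 * ?A + 6 * ?B"
    using m dev by linarith
  also have "\<dots> = (13 + c + 2 * \<bar>ln \<delta>\<bar>) * (?A + ?B)" by (simp add: algebra_simps)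
  finally have "2 / (real N * real D) * (4 * real D - ln mass + 2 * deviation w)
      \<le> 2 / (real N * real D) * ((13 + c + 2 * \<bar>ln \<delta>\<bar>) * (?A + ?B))"
    by (intro mult_left_mono) auto
  also have "\<dots> = 2 * (13 + c + 2 * \<bar>ln \<delta>\<bar>) * (real (\<Sum>d<D. e d) / (real D * real N) * ?L1 + real (\<Sum>k<K. dk k) / (real D * real N) * ?L2)"
    by (simp add: add_divide_distrib[symmetric] mult_ac)
  finally show ?thesis using risk_bound[OF w q] by linarith
qed

end

theorem theorem4p1:
  fixes c \<delta>0 :: real
  assumes "c > 1" and "\<delta>0 > 0"
  shows "\<exists>\<kappa>>0. \<exists>C>0.
    \<forall>(K :: nat \<Rightarrow> nat) (V :: nat \<Rightarrow> nat) (D :: nat \<Rightarrow> nat)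
     (\<gamma>s :: nat \<Rightarrow> nat \<Rightarrow> nat \<Rightarrow> real) (\<beta>s :: nat \<Rightarrow> nat \<Rightarrow> nat \<Rightarrow> real)
     (e :: nat \<Rightarrow> nat \<Rightarrow> nat) (dk :: nat \<Rightarrow> nat \<Rightarrow> nat).
      (\<forall>N. 0 < K N \<and> 0 < V N \<and> 0 < D N) \<longrightarrow>
      (\<forall>N. \<forall>d<D N. \<gamma>s N d \<in> prob_simplex (K N) \<and> m_sparse (K N) (e N d) (\<gamma>s N d) \<and>
         (\<forall>k<K N. \<gamma>s N d k \<noteq> 0 \<longrightarrow> \<delta>0 \<le> \<gamma>s N d k)) \<longrightarrow>
      (\<forall>N. \<forall>k<K N. \<beta>s N k \<in> prob_simplex (V N) \<and> m_sparse (V N) (dk N k) (\<beta>s N k) \<and>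
         (\<forall>v<V N. \<beta>s N k v \<noteq> 0 \<longrightarrow> \<delta>0 \<le> \<beta>s N k v)) \<longrightarrow>
      (\<forall>\<^sub>F N in sequentially.
         (\<forall>d<D N. real (e N d) \<le> \<kappa> * real (K N)) \<and>
         (\<forall>k<K N. real (dk N k) \<le> \<kappa> * real (V N))) \<longrightarrow>
      (\<lambda>N. (real (\<Sum>d<D N. e N d) + real (\<Sum>k<K N. dk N k)) / (real (D N) * real N))
         \<longlonglongrightarrow> 0 \<longrightarrow>
      (\<lambda>N. measure_pmf.prob (lda_data_pmf (K N) (V N) (D N) N (\<gamma>s N, \<beta>s N))
         {w. \<forall>q. lda_variational_solution c (K N) (V N) (D N) N w q \<longrightarrow>
            lda_hellinger_risk (K N) (V N) (D N) (\<gamma>s N, \<beta>s N)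
              (theta_marginal (K N) (V N) (D N) q)
            \<le> C * (real (\<Sum>d<D N. e N d) / (real (D N) * real N)
                     * ln (real (D N) * real (K N) * real N)
                   + real (\<Sum>k<K N. dk N k) / (real (D N) * real N)
                     * ln (real (K N) * real (V N) * real N))})
        \<longlonglongrightarrow> 1"
proof (intro exI conjI allI impI)
  let ?C = "2 * (13 + c + 2 * \<bar>ln \<delta>0\<bar>)"
  \<comment> \<open>The witnesses are still schematic at this point: this goal sets \<kappa> to 1
    and the next one sets C to \<open>?C\<close>.\<close>
  show "(0 :: real) < 1" by simp
  show "0 < ?C" using assms(1) by simp
  fix K V D :: "nat \<Rightarrow> nat" and \<gamma>s \<beta>s :: "nat \<Rightarrow> nat \<Rightarrow> nat \<Rightarrow> real" and e dk :: "nat \<Rightarrow> nat \<Rightarrow> nat"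
  assume pos: "\<forall>N. 0 < K N \<and> 0 < V N \<and> 0 < D N"
    and topics: "\<forall>N. \<forall>d<D N. \<gamma>s N d \<in> prob_simplex (K N) \<and> m_sparse (K N) (e N d) (\<gamma>s N d) \<and>
         (\<forall>k<K N. \<gamma>s N d k \<noteq> 0 \<longrightarrow> \<delta>0 \<le> \<gamma>s N d k)"
    and vocab: "\<forall>N. \<forall>k<K N. \<beta>s N k \<in> prob_simplex (V N) \<and> m_sparse (V N) (dk N k) (\<beta>s N k) \<and>
         (\<forall>v<V N. \<beta>s N k v \<noteq> 0 \<longrightarrow> \<delta>0 \<le> \<beta>s N k v)"
  let ?S = "\<lambda>N. {w. \<forall>q. lda_variational_solution c (K N) (V N) (D N) N w q \<longrightarrow>
            lda_hellinger_risk (K N) (V N) (D N) (\<gamma>s N, \<beta>s N)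
              (theta_marginal (K N) (V N) (D N) q)
            \<le> ?C * (real (\<Sum>d<D N. e N d) / (real (D N) * real N)
                     * ln (real (D N) * real (K N) * real N)
                   + real (\<Sum>k<K N. dk N k) / (real (D N) * real N)
                     * ln (real (K N) * real (V N) * real N))}"
  let ?p = "\<lambda>N. measure_pmf.prob (lda_data_pmf (K N) (V N) (D N) N (\<gamma>s N, \<beta>s N)) (?S N)"
  have lower: "1 - 1 / (\<delta>0 * \<delta>0 * ln (real N)) \<le> ?p N" if N3: "3 \<le> N" for N
  proof -
    interpret lda_truth "K N" "V N" "D N" N "\<gamma>s N" "\<beta>s N" \<delta>0 c
      using pos topics vocab assms N3 by unfold_locales auto
    have "1 - 1 / (\<delta>0 * \<delta>0 * ln (real N))
        \<le> measure_pmf.prob (lda_data_pmf (K N) (V N) (D N) N (\<gamma>s N, \<beta>s N)) {w. good w \<and> deviation w \<le> real (D N) * ln (real N)}"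
      \<comment> \<open>Here t = ln N: the failure probability
        \<open>1 / (\<delta>0 * \<delta>0 * ln N)\<close> vanishes, while D ln N is still of the
        order of the rate.\<close>
      using N3 by (intro prob_good_ge) simp
    also have "\<dots> \<le> ?p N"
    \<comment> \<open>For a pmf every set is measurable, including this event, which quantifies over
      all minimisers q.\<close>
    proof (rule measure_pmf.finite_measure_mono)
      show "{w. good w \<and> deviation w \<le> real (D N) * ln (real N)} \<subseteq> ?S N"
        using risk_bound_sparse[OF N3, of "e N" "dk N"] topics vocab by blast
    qed simp
    finally show ?thesis .
  qed
  have lim: "(\<lambda>N. 1 - 1 / (\<delta>0 * \<delta>0 * ln (real N))) \<longlonglongrightarrow> 1"
    using assms(2) by real_asymp
  show "?p \<longlonglongrightarrow> 1"
  proof (rule tendsto_sandwich[OF _ _ lim tendsto_const])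
    show "\<forall>\<^sub>F N in sequentially. 1 - 1 / (\<delta>0 * \<delta>0 * ln (real N)) \<le> ?p N"
      using lower by (rule eventually_sequentiallyI)
    show "\<forall>\<^sub>F N in sequentially. ?p N \<le> 1" by simp
  qed
qed

end
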